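(* Let $p$ be a prime and let $\sigma$ be a confined endomorphism of a vector group $\mathbf{G}_a^r$ over $\overline{\mathbf{F}}_p$ (in particular, this applies if $\sigma$ is a confined additive cellular automaton on the alphabet $\mathbf{F}_p^r$), with fixed point counts $\sigma_k=p^{kc-t_k|k|_p^{-1}}$, where $t_k$ is periodic of period $\varpi$ coprime to $p$. Then the Cesàro mean $$B=\lim_{X\to+\infty}\frac1X\sum_{k\le X}\frac{\sigma_k}{\Lambda^k}$$ equals $$B=\frac{p-1}{\varpi}\sum_{a=0}^{\varpi-1}\sum_{j\ge0}p^{-1-j-t_ap^j},$$ and $B$ is either transcendental or equal to $1$, where the latter case happens precisely if $\zeta_\sigma(z)\in\mathbf{C}(z)$ is a rational function, or, equivalently, if all $t_a=0$.
   Context: $\sigma_k$ ($k\ge1$) is the number of fixed points of $\sigma^k$ on $\mathcal{X}=\mathbf{G}_a^r(\overline{\mathbf{F}}_p)$ (respectively on $\mathcal{X}=(\mathbf{F}_p^r)^{\mathbf{Z}}$ for a cellular automaton); $\sigma$ is confined if all $\sigma_k$ are finite. $\Lambda:=\exp\limsup_{k\to\infty}\log(\sigma_k)/k$ is the growth rate and $\zeta_\sigma(z)=\exp\sum_{k\ge1}\sigma_kz^k/k$ the dynamical zeta function. An additive cellular automaton on the alphabet $V=\mathbf{F}_p^r$ is a map $V^{\mathbf{Z}}\to V^{\mathbf{Z}}$ that is continuous (product topology of the discrete topology on $V$), additive, and commutes with the shift. It is known that for such $\sigma$ one has $\sigma_k=p^{kc-t_k|k|_p^{-1}}$ with non-negative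 integers $c$ and $t_k$, where $(t_k)$ is periodic of some period $\varpi$ coprime to $p$, and $\Lambda=p^c$; set $t_0:=t_\varpi$. Here $|k|_p=p^{-v_p(k)}$. *)

theory Defs
  imports
    "HOL-Algebra.Algebraic_Closure_Type"
    "HOL-Computational_Algebra.Computational_Algebra"
    "HOL-Analysis.Analysis"
begin

hide_const (open) Divisibility.prime

definition fix_count :: "('x \<Rightarrow> 'x) \<Rightarrow> nat \<Rightarrow> nat" where
  "fix_count \<sigma> k = card {x. (\<sigma> ^^ k) x = x}"

definition confined :: "('x \<Rightarrow> 'x) \<Rightarrow> bool" where
  "confined \<sigma> \<longleftrightarrow> (\<forall>k\<ge>1. finite {x. (\<sigma> ^^ k) x = x})"

definition polynomial_fun :: "(('k :: comm_ring_1) ^ 'r \<Rightarrow> 'k) \<Rightarrow> bool" where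
  "polynomial_fun f \<longleftrightarrow> (\<exists>(M :: ('r \<Rightarrow> nat) set) c. finite M \<and>
     (\<forall>x. f x = (\<Sum>m\<in>M. c m * (\<Prod>i\<in>UNIV. (x $ i) ^ m i))))"

text \<open>
  An endomorphism of the algebraic group \<open>\<bold>G\<^sub>a\<^sup>r\<close> is a morphism of varieties that
  respects addition. Over an algebraically closed (in particular infinite) field, a morphism of
  affine spaces is determined by the polynomial map that it induces on points.
\<close>
definition vector_group_endo :: "(('k :: alg_closed_field) ^ 'r \<Rightarrow> 'k ^ 'r) \<Rightarrow> bool" where
  "vector_group_endo \<sigma> \<longleftrightarrow>
     (\<forall>i. polynomial_fun (\<lambda>x. \<sigma> x $ i)) \<and>
     (\<forall>x y. \<sigma> (x + y) = \<sigma> x + \<sigma> y)"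

definition additive_cellular_automaton ::
    "((int \<Rightarrow> 'v :: ab_group_add) \<Rightarrow> (int \<Rightarrow> 'v)) \<Rightarrow> bool" where
  "additive_cellular_automaton \<sigma> \<longleftrightarrow>
     continuous_map (product_topology (\<lambda>_. discrete_topology UNIV) UNIV)
                    (product_topology (\<lambda>_. discrete_topology UNIV) UNIV) \<sigma> \<and>
     (\<forall>x y. \<sigma> (\<lambda>i. x i + y i) = (\<lambda>i. \<sigma> x i + \<sigma> y i)) \<and>
     (\<forall>x. \<sigma> (\<lambda>i. x (i + 1)) = (\<lambda>i. \<sigma> x (i + 1)))"

definition padic_abs :: "nat \<Rightarrow> nat \<Rightarrow> real" where
  "padic_abs p k = real p powr (- real (multiplicity p k))"

text \<open>
  The next two notions depend on a system only through its fixed point counts \<open>s k\<close>, \<open>k \<ge> 1\<close>.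
  In the first, the limit superior is taken in the extended reals; the value is only meaningful
  if it is finite.
\<close>
definition growth_rate :: "(nat \<Rightarrow> nat) \<Rightarrow> real" where
  "growth_rate s = exp (real_of_ereal (limsup (\<lambda>k. ereal (ln (real (s k)) / real k))))"

definition dyn_zeta :: "(nat \<Rightarrow> nat) \<Rightarrow> complex fps" where
  "dyn_zeta s =
     fps_exp 1 oo Abs_fps (\<lambda>k. if k = 0 then 0 else of_nat (s k) / of_nat k)"

definition fps_rational :: "'a :: field fps \<Rightarrow> bool" where
  "fps_rational F \<longleftrightarrow> (\<exists>P Q. Q \<noteq> 0 \<and> fps_of_poly Q * F = fps_of_poly P)"

end

theory Submission
  imports Defs "HOL-Number_Theory.Cong"
begin

text \<open>
  Since \<open>\<Lambda> = p\<^sup>c\<close>, the quotient \<open>\<sigma>\<^sub>k / \<Lambda>\<^sup>k\<close> depends only on the residue of \<open>k\<close> modulo \<open>\<omega>\<close> and on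
  the \<open>p\<close>-adic valuation of \<open>k\<close>. Writing it as a telescoping sum over the powers of \<open>p\<close> that
  divide \<open>k\<close> reduces the Cesaro mean to counting residue classes, with a bounded total error.

  Transcendence is proved by Knight's ``oceans of zeros'' argument. If \<open>P\<close> is an integer polynomial
  of degree \<open>D\<close>, then expanding \<open>P\<close> at a sum of the terms \<open>b\<^bsup>-(j + \<tau> b\<^sup>j)\<^esup>\<close> gives tuples of at most
  \<open>D\<close> terms. For suitable \<open>n\<close>, a sum of \<open>D\<close> widely separated numbers \<open>\<tau> b\<^sup>j\<close>, only \<open>D\<close>-tuples can
  contribute an exponent near \<open>n\<close>, and then it is exactly \<open>n\<close>. The contribution of these
  tuples is too small to interact with the larger terms, which have bounded denominators, and too
  large to be cancelled by the smaller ones.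

  If \<open>\<zeta>\<^sub>\<sigma>\<close> is rational, its logarithmic derivative gives a linear recurrence for \<open>\<sigma>\<^sub>k\<close>.
\<close>

section \<open>Transcendence of lacunary sums\<close>

text \<open>
  With at most \<open>D\<close> summands, one of the \<open>D + 1\<close> blocks of exponents between two consecutive summands
  of the separated sum is not hit. Cutting both sums there, the upper parts are divisible by a large
  power of \<open>b\<close> and nearly equal, hence equal; so every cut must remove a summand.
\<close>
lemma sums_near_separated_sum:
  fixes b B R N D k m t0 :: nat and t j :: "nat \<Rightarrow> nat"
  assumes b: "b \<ge> 2" and k: "k \<le> D" and t: "\<And>l. l < k \<Longrightarrow> t l \<le> m"
    and t0: "1 \<le> t0" "t0 \<le> m" and B: "D * m + 1 < b ^ B" and R: "R = B * (D + 1)"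
    and near: "\<bar>int (\<Sum>l<k. t l * b ^ j l) - int (\<Sum>d<D. t0 * b ^ (R * (N + 1 + d)))\<bar>
                 \<le> int (b ^ (R * N))"
  shows "k = D \<and> (\<Sum>l<k. t l * b ^ j l) = (\<Sum>d<D. t0 * b ^ (R * (N + 1 + d)))"
proof -
  have "\<exists>\<beta>. R * (N + d) \<le> \<beta> \<and> \<beta> + B \<le> R * (N + d + 1) \<and> (\<forall>l<k. j l \<notin> {\<beta>..<\<beta> + B})" for d
  proof -
    have "\<exists>q\<le>D. \<forall>l<k. j l \<notin> {R * (N + d) + B * q..<R * (N + d) + B * q + B}"
    proof (rule ccontr)
      assume "\<not> ?thesis"
      then have "\<forall>q\<in>{..D}. \<exists>l<k. j l \<in> {R * (N + d) + B * q..<R * (N + d) + B * q + B}"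
        by auto
      then obtain f where f: "\<And>q. q \<le> D \<Longrightarrow> f q < k \<and>
          j (f q) \<in> {R * (N + d) + B * q..<R * (N + d) + B * q + B}"
        by (metis atMost_iff)
      \<comment> \<open>The window index \<open>q\<close> can be read off any exponent lying in that
        window. Hence \<open>f\<close> would inject \<open>D + 1\<close> windows into
        \<open>k \<le> D\<close> summands.\<close>
      have q: "q = (j (f q) - R * (N + d)) div B" if "q \<le> D" for q
      proof (rule sym, rule div_nat_eqI)
        show "B * q \<le> j (f q) - R * (N + d)" "j (f q) - R * (N + d) < B * Suc q"
          using f[OF that] by auto
      qed
      have "inj_on f {..D}"
        by (rule inj_on_inverseI[of _ "\<lambda>l. (j l - R * (N + d)) div B"]) (use q in auto)
      then have "card {..D} \<le> card {..<k}"
        by (rule card_inj_on_le) (use f in auto)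
      with k show False by simp
    qed
    then obtain q where q: "q \<le> D" "\<forall>l<k. j l \<notin> {R * (N + d) + B * q..<R * (N + d) + B * q + B}"
      by blast
    have "B * q + B \<le> R"
      using q(1) unfolding R by simp
    then show ?thesis
      using q(2) by (intro exI[of _ "R * (N + d) + B * q"]) (auto simp: algebra_simps)
  qed
  then obtain \<beta> where \<beta>: "\<And>d. R * (N + d) \<le> \<beta> d" "\<And>d. \<beta> d + B \<le> R * (N + d + 1)"
      "\<And>d l. l < k \<Longrightarrow> j l < \<beta> d \<or> \<beta> d + B \<le> j l"
    by (metis atLeastLessThan_iff not_less)
  \<comment> \<open>The conjunct \<open>d < D\<close> makes \<open>A D\<close> empty, in accordance
    with the empty sum \<open>V D\<close>, so that the chain of cuts has a common end point.\<close>
  define A where "A = (\<lambda>d. {l. l < k \<and> d < D \<and> \<beta> d \<le> j l})"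
  define U where "U = (\<lambda>d. \<Sum>l\<in>A d. t l * b ^ j l)"
  define V where "V = (\<lambda>d. \<Sum>d'\<in>{d..<D}. t0 * b ^ (R * (N + 1 + d')))"
  have finA: "finite (A d)" for d
    by (rule finite_subset[of _ "{..<k}"]) (auto simp: A_def)
  have UV: "U d = V d" if "d < D" for d
  proof -
    define u where "u = (\<Sum>l | l < k \<and> j l < \<beta> d. t l * b ^ j l)"
    define v where "v = (\<Sum>d'<d. t0 * b ^ (R * (N + 1 + d')))"
    have U: "(\<Sum>l<k. t l * b ^ j l) = U d + u"
      unfolding U_def u_def using that
      by (subst sum.union_disjoint[symmetric]) (auto simp: finA A_def intro!: sum.cong)
    have V: "(\<Sum>d<D. t0 * b ^ (R * (N + 1 + d))) = V d + v"
      unfolding V_def v_def using that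
      by (subst sum.union_disjoint[symmetric]) (auto intro!: sum.cong)
    have "u \<le> (\<Sum>l | l < k \<and> j l < \<beta> d. m * b ^ \<beta> d)"
      unfolding u_def using b by (intro sum_mono mult_mono t power_increasing) auto
    also have "\<dots> = card {l. l < k \<and> j l < \<beta> d} * (m * b ^ \<beta> d)" by simp
    also have "\<dots> \<le> D * (m * b ^ \<beta> d)"
    proof (rule mult_right_mono)
      have "card {l. l < k \<and> j l < \<beta> d} \<le> card {..<k}"
        by (rule card_mono) auto
      then show "card {l. l < k \<and> j l < \<beta> d} \<le> D" using k by simp
    qed simp
    finally have u: "u \<le> D * m * b ^ \<beta> d" by simp
    have "v \<le> (\<Sum>d'<d. m * b ^ \<beta> d)"
      unfolding v_def
    proof (intro sum_mono mult_mono t0 power_increasing)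
      fix d' assume "d' \<in> {..<d}"
      then have "R * (N + 1 + d') \<le> R * (N + d)"
        by (intro mult_left_mono) auto
      then show "R * (N + 1 + d') \<le> \<beta> d" using \<beta>(1)[of d] by simp
    qed (use b in auto)
    also have "\<dots> = d * (m * b ^ \<beta> d)" by simp
    also have "\<dots> \<le> D * (m * b ^ \<beta> d)"
      using that by (intro mult_right_mono) auto
    finally have v: "v \<le> D * m * b ^ \<beta> d" by simp
    have "b ^ (R * N) \<le> b ^ \<beta> d"
    proof (rule power_increasing)
      have "R * N \<le> R * (N + d)" by simp
      then show "R * N \<le> \<beta> d" using \<beta>(1)[of d] by linarith
    qed (use b in auto)
    then have L: "int (b ^ (R * N)) \<le> int (b ^ \<beta> d)" by linarith
    \<comment> \<open>Both \<open>u\<close> and \<open>v\<close> lie between 0 and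
      \<open>D * m * b ^ \<beta> d\<close>, so their difference costs this bound only once.\<close>
    have "\<bar>int (U d) - int (V d)\<bar> \<le> int (D * m * b ^ \<beta> d) + int (b ^ \<beta> d)"
      using near L u v unfolding U V by linarith
    also have "\<dots> = int ((D * m + 1) * b ^ \<beta> d)" by (simp add: algebra_simps)
    also have "\<dots> < int (b ^ B * b ^ \<beta> d)"
      unfolding of_nat_less_iff using B b by (intro mult_strict_right_mono) auto
    finally have lt: "\<bar>int (U d) - int (V d)\<bar> < int (b ^ (\<beta> d + B))"
      by (simp add: power_add mult.commute)
    have "b ^ (\<beta> d + B) dvd U d"
      unfolding U_def
    proof (intro dvd_sum dvd_mult le_imp_power_dvd)
      fix l assume "l \<in> A d"
      then show "\<beta> d + B \<le> j l" using \<beta>(3)[of l d] by (auto simp: A_def)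
    qed
    moreover have "b ^ (\<beta> d + B) dvd V d"
      unfolding V_def
    proof (intro dvd_sum dvd_mult le_imp_power_dvd)
      fix d' assume "d' \<in> {d..<D}"
      then have "R * (N + d + 1) \<le> R * (N + 1 + d')"
        by (intro mult_left_mono) auto
      then show "\<beta> d + B \<le> R * (N + 1 + d')" using \<beta>(2)[of d] by linarith
    qed
    ultimately have "int (b ^ (\<beta> d + B)) dvd int (U d) - int (V d)"
      by (intro dvd_diff) (simp_all only: int_dvd_int_iff)
    with lt have "int (U d) - int (V d) = 0"
      using zdvd_not_zless[of "\<bar>int (U d) - int (V d)\<bar>" "int (b ^ (\<beta> d + B))"] by force
    then show ?thesis by simp
  qed
  have UV': "U d = V d" if "d \<le> D" for d
    using that UV[of d] by (cases "d = D") (auto simp: U_def V_def A_def)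
  have psub: "A (Suc d) \<subset> A d" if "d < D" for d
  proof -
    have "\<beta> d \<le> \<beta> (Suc d)" using \<beta>(1)[of "Suc d"] \<beta>(2)[of d] by simp
    then have "A (Suc d) \<subseteq> A d" by (auto simp: A_def)
    \<comment> \<open>Passing from \<open>d\<close> to \<open>Suc d\<close> removes a nonzero term
      from \<open>V\<close>. As \<open>U\<close> agrees with \<open>V\<close>, it must lose an index
      too.\<close>
    moreover have "V d = t0 * b ^ (R * (N + 1 + d)) + V (Suc d)"
      unfolding V_def using that by (simp add: sum.atLeast_Suc_lessThan)
    then have "V d \<noteq> V (Suc d)" using t0 b by simp
    then have "A (Suc d) \<noteq> A d" using UV'[of d] UV'[of "Suc d"] that by (auto simp: U_def)
    ultimately show ?thesis by blast
  qed
  \<comment> \<open>The \<open>D\<close> strict inclusions, counted upwards from the empty set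
    \<open>A D\<close>, give \<open>card (A 0) \<ge> D\<close>. This forces \<open>k = D\<close> and
    \<open>A 0\<close> to contain every index, so the equality of the upper parts at
    \<open>d = 0\<close> is that of the full sums.\<close>
  have "i \<le> D \<Longrightarrow> i \<le> card (A (D - i))" for i
  proof (induction i)
    case (Suc i)
    then have "A (D - i) \<subset> A (D - Suc i)" using psub[of "D - Suc i"] by (simp add: Suc_diff_Suc)
    then have "card (A (D - i)) < card (A (D - Suc i))" by (rule psubset_card_mono[OF finA])
    then show ?case using Suc by simp
  qed simp
  from this[of D] have D: "D \<le> card (A 0)" by simp
  have sub: "A 0 \<subseteq> {..<k}" by (auto simp: A_def)
  then have "card (A 0) \<le> k" using card_mono[of "{..<k}" "A 0"] by simp
  then have "k = D" "card (A 0) = card {..<k}" using D k by auto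
  moreover from this have "A 0 = {..<k}" using card_subset_eq[OF _ sub] by simp
  ultimately show ?thesis using UV'[of 0] by (auto simp: U_def V_def lessThan_atLeast0)
qed

lemma power_sum_eq_sum_tuples:
  fixes x :: "'a :: comm_semiring_1"
  assumes "finite A"
  shows "(\<Sum>a\<in>A. x ^ f a) ^ k = (\<Sum>g\<in>PiE {..<k} (\<lambda>_. A). x ^ (\<Sum>l<k. f (g l)))"
proof -
  have "(\<Sum>a\<in>A. x ^ f a) ^ k = (\<Prod>l<k. \<Sum>a\<in>A. x ^ f a)" by simp
  also have "\<dots> = (\<Sum>g\<in>PiE {..<k} (\<lambda>_. A). \<Prod>l<k. x ^ f (g l))"
    using assms by (subst prod_sum_PiE) auto
  finally show ?thesis by (simp add: power_sum)
qed

text \<open>The exponents are governed by \<open>e\<close>, with a perturbation \<open>J\<close> of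
  size at most \<open>E\<close>. If the sum were small, the terms with \<open>e g + L < n\<close>,
  scaled by a power of \<open>b\<close>, would add up to an integer of absolute value below 1, hence
  to 0. The terms with \<open>e g = n\<close> share one coefficient, cannot cancel, and amount to at
  least \<open>x ^ (E + n)\<close>. By \<open>large\<close> this is too much for the remaining terms
  and the assumed bound.\<close>

lemma isolated_exponent_lower_bound:
  fixes b n L E :: nat and c :: "'g \<Rightarrow> int" and J e :: "'g \<Rightarrow> nat" and C K x :: real
  assumes b: "b \<ge> 2" and x: "x = 1 / real b" and G: "finite G" and g0: "g0 \<in> G" "e g0 = n"
    and split: "\<And>g. g \<in> G \<Longrightarrow> e g + L < n \<or> e g = n \<or> n + L < e g"
    and J: "\<And>g. g \<in> G \<Longrightarrow> J g \<le> E" and K: "\<And>g. g \<in> G \<Longrightarrow> \<bar>real_of_int (c g)\<bar> \<le> K"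
    and a: "a \<noteq> 0" "\<And>g. g \<in> G \<Longrightarrow> e g = n \<Longrightarrow> c g = a"
    and C: "0 \<le> C" and L: "L \<le> n"
    and large: "(C + 2 * K * real (card G)) * real b ^ E < real b ^ L"
  shows "C * x ^ (n + L) < \<bar>\<Sum>g\<in>G. real_of_int (c g) * x ^ (J g + e g)\<bar>"
proof (rule ccontr)
  define s where "s = (\<lambda>Y. \<Sum>g\<in>Y. real_of_int (c g) * x ^ (J g + e g))"
  define lo mid hi where "lo = {g\<in>G. e g + L < n}" and "mid = {g\<in>G. e g = n}"
    and "hi = {g\<in>G. n + L < e g}"
  assume "\<not> ?thesis"
  then have small: "\<bar>s G\<bar> \<le> C * x ^ (n + L)" by (simp add: s_def)
  have x01: "0 < x" "x \<le> 1" and b0: "real b > 0" using b by (auto simp: x)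
  have xb: "x * real b = 1" using b by (simp add: x)
  have pow_xb: "x ^ i * real b ^ i = 1" for i
    using xb by (simp flip: power_mult_distrib)
  have G': "G = lo \<union> mid \<union> hi" using split by (auto simp: lo_def mid_def hi_def)
  have fin: "finite lo" "finite mid" "finite hi" using G by (auto simp: lo_def mid_def hi_def)
  have sG: "s G = s lo + s mid + s hi"
    unfolding s_def by (subst G', subst sum.union_disjoint, use fin in \<open>auto simp: lo_def mid_def hi_def\<close>)
      (subst sum.union_disjoint, use fin in \<open>auto simp: lo_def mid_def hi_def\<close>)
  have K0: "0 \<le> K" using K[OF g0(1)] by linarith
  have bound: "\<bar>s Y\<bar> \<le> K * real (card G) * x ^ q"
    if "Y \<subseteq> G" "\<And>g. g \<in> Y \<Longrightarrow> q \<le> e g" for Y q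
  proof -
    have "\<bar>s Y\<bar> \<le> (\<Sum>g\<in>Y. \<bar>real_of_int (c g) * x ^ (J g + e g)\<bar>)"
      unfolding s_def by (rule sum_abs)
    also have "\<dots> \<le> (\<Sum>g\<in>Y. K * x ^ q)"
    proof (rule sum_mono)
      fix g assume "g \<in> Y"
      then have "\<bar>real_of_int (c g)\<bar> \<le> K" "x ^ (J g + e g) \<le> x ^ q"
        using that K x01 by (auto intro!: power_decreasing trans_le_add2)
      then show "\<bar>real_of_int (c g) * x ^ (J g + e g)\<bar> \<le> K * x ^ q"
        using x01 by (auto simp: abs_mult intro!: mult_mono)
    qed
    also have "\<dots> = real (card Y) * (K * x ^ q)" by simp
    also have "\<dots> \<le> real (card G) * (K * x ^ q)"
      using that(1) G K0 x01 by (intro mult_right_mono) (auto intro: card_mono)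
    finally show ?thesis by (simp add: algebra_simps)
  qed
  have mid: "\<bar>s mid\<bar> \<le> K * real (card G) * x ^ n"
    by (rule bound) (auto simp: mid_def)
  have hi: "\<bar>s hi\<bar> \<le> K * real (card G) * x ^ (n + L)"
    by (rule bound) (auto simp: hi_def)
  have xL: "x ^ (n + L) \<le> x ^ n" using x01 by (intro power_decreasing) auto
  have "\<bar>s lo\<bar> \<le> C * x ^ (n + L) + K * real (card G) * x ^ n + K * real (card G) * x ^ (n + L)"
    using small mid hi unfolding sG by linarith
  also have "\<dots> \<le> C * x ^ n + K * real (card G) * x ^ n + K * real (card G) * x ^ n"
    using xL C K0 by (intro add_mono mult_left_mono) auto
  finally have lo: "\<bar>s lo\<bar> \<le> (C + 2 * K * real (card G)) * x ^ n"
    by (simp add: algebra_simps)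
  \<comment> \<open>On \<open>lo\<close> the total exponent \<open>J g + e g\<close> is at most
    \<open>E + (n - L)\<close>, so this power of \<open>b\<close> clears all denominators.\<close>
  define z where "z = s lo * real b ^ (n - L + E)"
  have "z = (\<Sum>g\<in>lo. real_of_int (c g * int b ^ (n - L + E - (J g + e g))))"
    unfolding z_def s_def sum_distrib_right
  proof (rule sum.cong)
    fix g assume g: "g \<in> lo"
    then have le: "J g + e g \<le> n - L + E" using J[of g] by (auto simp: lo_def)
    have "real b ^ (n - L + E) = real b ^ (J g + e g) * real b ^ (n - L + E - (J g + e g))"
      using le by (simp flip: power_add)
    then have "x ^ (J g + e g) * real b ^ (n - L + E) = real b ^ (n - L + E - (J g + e g))"
      using pow_xb[of "J g + e g"] by (metis mult.assoc mult_1)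
    then show "real_of_int (c g) * x ^ (J g + e g) * real b ^ (n - L + E) =
        real_of_int (c g * int b ^ (n - L + E - (J g + e g)))"
      by (simp add: mult.assoc)
  qed simp
  then have "z \<in> \<int>" by (auto intro!: Ints_sum Ints_mult Ints_power)
  moreover have "\<bar>z\<bar> < 1"
  proof -
    have xn: "x ^ n * real b ^ (n - L) = x ^ L"
    proof -
      have "x ^ n = x ^ (n - L) * x ^ L" using L by (simp flip: power_add)
      then show ?thesis using pow_xb[of "n - L"] by (metis mult.assoc mult.commute mult_1)
    qed
    have "\<bar>z\<bar> \<le> (C + 2 * K * real (card G)) * x ^ n * real b ^ (n - L + E)"
      using lo unfolding z_def by (auto simp: abs_mult intro!: mult_right_mono)
    also have "\<dots> = (C + 2 * K * real (card G)) * real b ^ E * x ^ L"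
      unfolding power_add xn[symmetric] by (simp add: algebra_simps)
    also have "\<dots> < real b ^ L * x ^ L"
      using large x01 by (intro mult_strict_right_mono) auto
    finally show ?thesis using pow_xb[of L] by (simp add: mult.commute)
  qed
  ultimately have "z = 0" using Ints_nonzero_abs_less1 by blast
  then have "s lo = 0" using b by (simp add: z_def)
  \<comment> \<open>The single term of \<open>g0\<close> already bounds the middle part from below,
    since the sum over \<open>mid\<close> has positive terms up to the common factor
    \<open>a\<close>.\<close>
  have "x ^ (E + n) \<le> x ^ (J g0 + e g0)"
    using J[OF g0(1)] g0 x01 by (intro power_decreasing) auto
  also have "\<dots> \<le> (\<Sum>g\<in>mid. x ^ (J g + e g))"
    by (rule member_le_sum) (use g0 fin x01 in \<open>auto simp: mid_def\<close>)
  also have "\<dots> \<le> \<bar>real_of_int a\<bar> * (\<Sum>g\<in>mid. x ^ (J g + e g))"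
  proof -
    have "1 \<le> \<bar>real_of_int a\<bar>" using a(1) by linarith
    then have "1 * (\<Sum>g\<in>mid. x ^ (J g + e g)) \<le> \<bar>real_of_int a\<bar> * (\<Sum>g\<in>mid. x ^ (J g + e g))"
      using x01 by (intro mult_right_mono sum_nonneg) auto
    then show ?thesis by simp
  qed
  also have "\<dots> = \<bar>s mid\<bar>"
  proof -
    have "s mid = real_of_int a * (\<Sum>g\<in>mid. x ^ (J g + e g))"
      unfolding s_def sum_distrib_left using a(2) by (intro sum.cong) (auto simp: mid_def)
    then show ?thesis using x01 by (simp add: abs_mult sum_nonneg)
  qed
  also have "\<dots> \<le> C * x ^ (n + L) + K * real (card G) * x ^ (n + L)"
    using small hi \<open>s lo = 0\<close> unfolding sG by linarith
  also have "\<dots> \<le> (C + 2 * K * real (card G)) * x ^ (n + L)"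
    using K0 x01 by (simp add: algebra_simps)
  finally have "x ^ E \<le> (C + 2 * K * real (card G)) * x ^ L"
    using x01 by (simp add: power_add mult.commute mult.left_commute)
  then have "x ^ E * (real b ^ E * real b ^ L) \<le>
      (C + 2 * K * real (card G)) * x ^ L * (real b ^ E * real b ^ L)"
    using b0 by (intro mult_right_mono) auto
  then have "(x ^ E * real b ^ E) * real b ^ L \<le>
      (C + 2 * K * real (card G)) * real b ^ E * (x ^ L * real b ^ L)"
    by (simp only: mult_ac)
  then show False using large unfolding pow_xb by simp
qed

section \<open>Estimates for truncating the series\<close>

lemma poly_lipschitz_on_Icc:
  fixes P :: "real poly"
  obtains C where "C \<ge> 0"
    "\<And>x y. \<lbrakk>0 \<le> x; x \<le> y; y \<le> S\<rbrakk> \<Longrightarrow> \<bar>poly P x - poly P y\<bar> \<le> C * (y - x)"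
proof -
  have "bounded (poly (pderiv P) ` {0..S})"
    by (intro compact_imp_bounded compact_continuous_image continuous_intros) auto
  then obtain C where C: "\<forall>x\<in>{0..S}. norm (poly (pderiv P) x) \<le> C" "C > 0"
    unfolding bounded_pos by auto
  show ?thesis
  proof
    fix x y :: real assume xy: "0 \<le> x" "x \<le> y" "y \<le> S"
    show "\<bar>poly P x - poly P y\<bar> \<le> C * (y - x)"
    proof (cases "x = y")
      case False
      with xy obtain z where z: "x < z" "z < y" "poly P y - poly P x = (y - x) * poly (pderiv P) z"
        using poly_MVT[of x y P] by auto
      have "\<bar>poly (pderiv P) z\<bar> \<le> C" using C(1) z xy by auto
      then have "(y - x) * \<bar>poly (pderiv P) z\<bar> \<le> (y - x) * C"
        using xy by (intro mult_left_mono) auto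
      moreover have "\<bar>poly P x - poly P y\<bar> = (y - x) * \<bar>poly (pderiv P) z\<bar>"
        using z(3) xy by (subst abs_minus_commute) (simp add: abs_mult)
      ultimately show ?thesis by (simp add: mult.commute)
    qed simp
  qed (use C(2) in simp)
qed

text \<open>Since \<open>x \<le> 1 / 2\<close> and \<open>t \<ge> 1\<close>, the term of index
  \<open>j\<close> is at most \<open>(1 / 2) ^ j * x ^ (b ^ j)\<close>. A geometric series therefore
  dominates the tail, with a bound uniform in \<open>t\<close>.\<close>

lemma lacunary_series_tail:
  fixes b t M :: nat and x :: real
  assumes b: "b \<ge> 2" and x: "x = 1 / real b" and t: "t \<ge> 1"
  shows "summable (\<lambda>j. x ^ (j + t * b ^ j))"
    and "(\<Sum>j<M. x ^ (j + t * b ^ j)) \<le> (\<Sum>j. x ^ (j + t * b ^ j))"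
    and "(\<Sum>j. x ^ (j + t * b ^ j)) \<le> (\<Sum>j<M. x ^ (j + t * b ^ j)) + 2 * x ^ (b ^ M)"
proof -
  have x01: "0 < x" "x \<le> 1 / 2" using b by (auto simp: x field_simps)
  have le: "x ^ (j + t * b ^ j) \<le> (1 / 2) ^ j * x ^ (b ^ j)" for j
  proof -
    have "x ^ j \<le> (1 / 2) ^ j" using x01 by (intro power_mono) auto
    moreover have "x ^ (t * b ^ j) \<le> x ^ (b ^ j)"
      using x01 t by (intro power_decreasing) auto
    ultimately show ?thesis using x01 by (auto simp: power_add intro!: mult_mono)
  qed
  show sm: "summable (\<lambda>j. x ^ (j + t * b ^ j))"
  proof (rule summable_comparison_test')
    show "summable (\<lambda>j. (1 / 2 :: real) ^ j)" by (simp add: summable_geometric)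
    fix j :: nat assume "j \<ge> 0"
    have "(1 / 2) ^ j * x ^ (b ^ j) \<le> (1 / 2) ^ j * 1"
      using x01 by (intro mult_left_mono) (auto intro: power_le_one)
    from order.trans[OF le this] x01 show "norm (x ^ (j + t * b ^ j)) \<le> (1 / 2) ^ j" by simp
  qed
  show "(\<Sum>j<M. x ^ (j + t * b ^ j)) \<le> (\<Sum>j. x ^ (j + t * b ^ j))"
    using x01 by (intro sum_le_suminf sm) auto
  have "(\<Sum>j. x ^ (j + t * b ^ j)) =
      (\<Sum>j. x ^ ((j + M) + t * b ^ (j + M))) + (\<Sum>j<M. x ^ (j + t * b ^ j))"
    by (rule suminf_split_initial_segment[OF sm])
  also have "(\<Sum>j. x ^ ((j + M) + t * b ^ (j + M))) \<le> (\<Sum>j. x ^ (b ^ M) * (1 / 2) ^ j)"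
  proof (rule suminf_le)
    fix j
    have "(1 / 2 :: real) ^ (j + M) \<le> (1 / 2) ^ j" by (intro power_decreasing) auto
    moreover have "x ^ (b ^ (j + M)) \<le> x ^ (b ^ M)"
      using x01 b by (intro power_decreasing power_increasing) auto
    ultimately have "(1 / 2) ^ (j + M) * x ^ (b ^ (j + M)) \<le> (1 / 2) ^ j * x ^ (b ^ M)"
      using x01 by (intro mult_mono) auto
    then show "x ^ ((j + M) + t * b ^ (j + M)) \<le> x ^ (b ^ M) * (1 / 2) ^ j"
      using le[of "j + M"] by (simp add: mult.commute)
  next
    show "summable (\<lambda>j. x ^ ((j + M) + t * b ^ (j + M)))"
      using summable_ignore_initial_segment[OF sm, of M] .
  qed (auto intro: summable_mult summable_geometric)
  also have "(\<Sum>j. x ^ (b ^ M) * (1 / 2 :: real) ^ j) = 2 * x ^ (b ^ M)"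
    by (subst suminf_mult) (auto simp: suminf_geometric summable_geometric)
  finally show "(\<Sum>j. x ^ (j + t * b ^ j)) \<le> (\<Sum>j<M. x ^ (j + t * b ^ j)) + 2 * x ^ (b ^ M)"
    by simp
qed

text \<open>This serves to choose \<open>N\<close> so that the gap \<open>b ^ (R * N)\<close> beats
  quantities linear in \<open>N\<close>. The witness is \<open>2 * s\<close>: squaring
  \<open>s + 1 \<le> 2 ^ s\<close> gives a quadratic lower bound, whose term \<open>s * s\<close>
  absorbs \<open>2 * d * s\<close>.\<close>

lemma linear_le_exp2: "\<exists>N. a + d * N \<le> (2 :: nat) ^ N"
proof
  define s where "s = a + 2 * d"
  have "a + d * (2 * s) \<le> (s + 1) * (s + 1)"
    by (simp add: s_def algebra_simps)
  also have "\<dots> \<le> 2 ^ s * 2 ^ s"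
    by (intro mult_mono) (simp_all add: Suc_leI)
  finally show "a + d * (2 * s) \<le> 2 ^ (2 * s)"
    by (simp add: power_add mult_2)
qed

text \<open>An annihilating integer polynomial \<open>P\<close> is evaluated at a partial sum
  \<open>F\<close>. As \<open>P\<close> vanishes at the full sum, the Lipschitz bound makes
  \<open>poly P F\<close> of order at most \<open>x ^ (n + L)\<close>. Its expansion over tuples has
  the exponent \<open>n\<close> isolated, which makes it larger than that.\<close>

theorem lacunary_sum_transcendental:
  fixes b :: nat and t :: "'i \<Rightarrow> nat"
  assumes b: "b \<ge> 2" and I: "finite I" "I \<noteq> {}" and t: "\<And>i. i \<in> I \<Longrightarrow> t i \<ge> 1"
  shows "\<not> algebraic (\<Sum>i\<in>I. \<Sum>j. (1 / real b) ^ (j + t i * b ^ j))"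
proof
  define x where "x = 1 / real b"
  define S where "S = (\<Sum>i\<in>I. \<Sum>j. x ^ (j + t i * b ^ j))"
  assume "algebraic (\<Sum>i\<in>I. \<Sum>j. (1 / real b) ^ (j + t i * b ^ j))"
  then have "algebraic S" by (simp only: S_def x_def)
  then obtain P :: "real poly" where P: "\<forall>k. coeff P k \<in> \<int>" "P \<noteq> 0" "poly P S = 0"
    unfolding algebraic_def by blast
  have "\<forall>k. \<exists>c. coeff P k = real_of_int c"
    using P(1) by (auto elim: Ints_cases)
  then obtain c where c: "\<And>k. coeff P k = real_of_int (c k)"
    by metis
  define D where "D = Polynomial.degree P"
  have x01: "0 < x" "x \<le> 1" using b by (auto simp: x_def)
  have D: "D \<ge> 1"
  proof (rule ccontr)
    assume "\<not> ?thesis"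
    then have "Polynomial.degree P = 0" by (simp add: D_def)
    then obtain r where "P = [:r:]" by (rule degree_eq_zeroE)
    with P(2,3) show False by simp
  qed
  obtain i0 where i0: "i0 \<in> I" using I by auto
  define m where "m = Max (t ` I)"
  have m: "t i \<le> m" if "i \<in> I" for i using that I by (simp add: m_def)
  obtain B where B: "D * m + 1 < b ^ B"
  proof
    have "D * m + 1 < 2 ^ (D * m + 1)" by (rule less_exp)
    also have "\<dots> \<le> b ^ (D * m + 1)" using b by (intro power_mono) auto
    finally show "D * m + 1 < b ^ (D * m + 1)" .
  qed
  have B1: "B \<ge> 1" using B by (cases B) auto
  define R where "R = B * (D + 1)"
  have R1: "R \<ge> 1" "B \<le> R" using B1 by (auto simp: R_def)
  obtain lip where lip: "lip \<ge> 0"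
    "\<And>x y. \<lbrakk>0 \<le> x; x \<le> y; y \<le> S\<rbrakk> \<Longrightarrow> \<bar>poly P x - poly P y\<bar> \<le> lip * (y - x)"
    using poly_lipschitz_on_Icc[of S P] by blast
  define C where "C = lip * (2 * real (card I))"
  define K where "K = (\<Sum>k\<le>D. \<bar>real_of_int (c k)\<bar>)"
  have C0: "C \<ge> 0" and K0: "K \<ge> 0" using lip(1) by (auto simp: C_def K_def sum_nonneg)
  define W where "W = C + 2 * K * (real (D + 1) * real (card I) ^ D)"
  have W0: "W \<ge> 0" using C0 K0 by (simp add: W_def)
  obtain Q where Q: "W < real b ^ Q"
    using real_arch_pow[of "real b" W] b by auto
  \<comment> \<open>The left side is \<open>Q + 2 * (D * M)\<close> for the \<open>M\<close> below.
    Here \<open>b ^ Q\<close> absorbs the constants independent of \<open>N\<close>. One factor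
    \<open>b ^ (D * M)\<close> bounds the number of tuples, the other comes from the exponents
    \<open>J\<close>.\<close>
  obtain N where N: "(Q + 2 * D * R * (D + 1)) + (2 * D * R) * N \<le> 2 ^ N"
    using linear_le_exp2 by blast
  \<comment> \<open>The largest index used in \<open>n\<close> is \<open>R * (N + D)\<close>. One
    more step of size \<open>R\<close> keeps all summands of \<open>n\<close> within the truncation
    and gives \<open>n + L \<le> b ^ M\<close>, which controls the tail.\<close>
  define M where "M = R * (N + D + 1)"
  define L where "L = b ^ (R * N)"
  define n where "n = (\<Sum>d<D. t i0 * b ^ (R * (N + 1 + d)))"
  have M1: "M \<ge> 1" using R1 by (simp add: M_def)
  have QL: "Q + 2 * (D * M) \<le> L"
  proof -
    have "Q + 2 * (D * M) \<le> 2 ^ N" using N by (simp add: M_def algebra_simps)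
    also have "\<dots> \<le> b ^ N" using b by (intro power_mono) auto
    also have "\<dots> \<le> b ^ (R * N)" using b R1 by (intro power_increasing) auto
    finally show ?thesis by (simp add: L_def)
  qed
  have nL: "n + L \<le> b ^ M"
  proof -
    have "n \<le> (\<Sum>d<D. m * b ^ (R * (N + D)))"
      unfolding n_def
    proof (intro sum_mono)
      fix d assume "d \<in> {..<D}"
      then have "R * (N + 1 + d) \<le> R * (N + D)" by (intro mult_left_mono) auto
      then have "b ^ (R * (N + 1 + d)) \<le> b ^ (R * (N + D))"
        using b by (intro power_increasing) auto
      then show "t i0 * b ^ (R * (N + 1 + d)) \<le> m * b ^ (R * (N + D))"
        by (rule mult_mono[OF m[OF i0]]) auto
    qed
    moreover have "L \<le> b ^ (R * (N + D))"
      unfolding L_def using b by (intro power_increasing mult_left_mono) auto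
    ultimately have "n + L \<le> (D * m + 1) * b ^ (R * (N + D))" by (simp add: algebra_simps)
    also have "\<dots> \<le> b ^ R * b ^ (R * (N + D))"
    proof (rule mult_right_mono)
      have "b ^ B \<le> b ^ R" using b R1 by (intro power_increasing) auto
      with B show "D * m + 1 \<le> b ^ R" by linarith
    qed simp
    also have "\<dots> = b ^ (R + R * (N + D))" by (simp only: power_add)
    also have "R + R * (N + D) = M" by (simp add: M_def)
    finally show ?thesis .
  qed
  have Ln: "L \<le> n"
  proof -
    have "L \<le> 1 * b ^ (R * (N + 1 + 0))"
      unfolding L_def using b by (simp add: power_increasing)
    also have "\<dots> \<le> t i0 * b ^ (R * (N + 1 + 0))"
      using t[OF i0] by (intro mult_right_mono) auto
    also have "\<dots> \<le> n"
      unfolding n_def using D by (intro member_le_sum) auto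
    finally show ?thesis .
  qed
  define A where "A = I \<times> {..<M}"
  have A: "finite A" "card A = card I * M" using I by (auto simp: A_def)
  define F where "F = (\<Sum>a\<in>A. x ^ (snd a + t (fst a) * b ^ snd a))"
  have F: "F = (\<Sum>i\<in>I. \<Sum>j<M. x ^ (j + t i * b ^ j))"
    unfolding F_def A_def by (simp add: sum.cartesian_product case_prod_beta)
  have xx: "b \<ge> 2" "x = 1 / real b" using b by (simp_all add: x_def)
  have "F \<le> S" unfolding F S_def
    by (intro sum_mono lacunary_series_tail(2)[OF xx] t)
  have "S \<le> (\<Sum>i\<in>I. (\<Sum>j<M. x ^ (j + t i * b ^ j)) + 2 * x ^ (b ^ M))"
    unfolding S_def by (intro sum_mono lacunary_series_tail(3)[OF xx] t)
  then have "S - F \<le> 2 * real (card I) * x ^ (b ^ M)" by (simp add: F sum.distrib)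
  also have "\<dots> \<le> 2 * real (card I) * x ^ (n + L)"
    using x01 nL by (intro mult_left_mono power_decreasing) auto
  finally have SF: "S - F \<le> 2 * real (card I) * x ^ (n + L)" .
  have "0 \<le> F" unfolding F_def using x01 by (intro sum_nonneg) auto
  then have "\<bar>poly P F\<bar> \<le> lip * (S - F)"
    using lip(2)[of F S] \<open>F \<le> S\<close> P(3) by simp
  also have "\<dots> \<le> lip * (2 * real (card I) * x ^ (n + L))"
    using SF lip(1) by (intro mult_left_mono) auto
  finally have small: "\<bar>poly P F\<bar> \<le> C * x ^ (n + L)" by (simp add: C_def)
  \<comment> \<open>The length \<open>k\<close> of a tuple records the power of \<open>F\<close>
    from which it arises; \<open>J\<close> collects the indices \<open>j\<close> and
    \<open>e\<close> the large parts \<open>t * b ^ j\<close> of the exponents.\<close>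
  define G where "G = Sigma {..D} (\<lambda>k. PiE {..<k} (\<lambda>_. A))"
  define J where "J = (\<lambda>(k, g :: nat \<Rightarrow> 'i \<times> nat). \<Sum>l<k. snd (g l))"
  define e where "e = (\<lambda>(k, g :: nat \<Rightarrow> 'i \<times> nat). \<Sum>l<k. t (fst (g l)) * b ^ snd (g l))"
  have finG: "finite G" unfolding G_def using A by (intro finite_SigmaI finite_PiE) auto
  have "poly P F = (\<Sum>k\<le>D. coeff P k * F ^ k)"
    by (simp add: poly_altdef D_def)
  also have "\<dots> = (\<Sum>k\<le>D. \<Sum>g\<in>PiE {..<k} (\<lambda>_. A). real_of_int (c k) * x ^ (J (k, g) + e (k, g)))"
    by (simp add: F_def power_sum_eq_sum_tuples[OF A(1)] c sum_distrib_left J_def e_def sum.distrib)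
  also have "\<dots> = (\<Sum>h\<in>G. real_of_int (c (fst h)) * x ^ (J h + e h))"
    unfolding G_def using A by (subst sum.Sigma) (auto intro!: finite_PiE simp: case_prod_beta)
  finally have PF: "poly P F = (\<Sum>h\<in>G. real_of_int (c (fst h)) * x ^ (J h + e h))" .
  have mem: "fst (g l) \<in> I" "snd (g l) < M" "k \<le> D" if "(k, g) \<in> G" "l < k" for k g l
    using that by (auto simp: G_def A_def PiE_def Pi_def mem_Times_iff)
  have near: "k = D \<and> e (k, g) = n"
    if "(k, g) \<in> G" "\<bar>int (e (k, g)) - int n\<bar> \<le> int L" for k g
  proof -
    have "k \<le> D" using that(1) by (auto simp: G_def)
    then show ?thesis
      using sums_near_separated_sum[OF b \<open>k \<le> D\<close>, of "\<lambda>l. t (fst (g l))" m "t i0" B R "\<lambda>l. snd (g l)" N]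
        mem[OF that(1)] m t i0 B R_def that(2)
      by (auto simp: n_def L_def e_def)
  qed
  \<comment> \<open>This tuple spells out the definition of \<open>n\<close>, so the exponent
    \<open>n\<close> does occur.\<close>
  define h0 where "h0 = (D, \<lambda>l\<in>{..<D}. (i0, R * (N + 1 + l)))"
  have "h0 \<in> G"
  proof -
    have "R * (N + 1 + l) < M" if "l < D" for l
      unfolding M_def using that R1 by (intro mult_strict_left_mono) auto
    then show ?thesis using i0 by (auto simp: h0_def G_def A_def)
  qed
  have card_G: "real (card G) \<le> real (D + 1) * real (card I) ^ D * real b ^ (D * M)"
  proof -
    have cA: "1 \<le> card A" using A(2) M1 I by (simp add: Suc_le_eq card_gt_0_iff)
    have "card G = (\<Sum>k\<le>D. card A ^ k)"
      unfolding G_def using A by (subst card_SigmaI) (auto intro!: finite_PiE simp: card_PiE)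
    also have "\<dots> \<le> (\<Sum>k\<le>D. card A ^ D)"
      using cA by (intro sum_mono power_increasing) auto
    also have "\<dots> = (D + 1) * (card I ^ D * M ^ D)" by (simp add: A(2) power_mult_distrib)
    also have "\<dots> \<le> (D + 1) * (card I ^ D * b ^ (D * M))"
    proof (intro mult_left_mono)
      have "M \<le> 2 ^ M" using less_exp[of M] by simp
      also have "\<dots> \<le> b ^ M" using b by (intro power_mono) auto
      finally have "M ^ D \<le> (b ^ M) ^ D" by (intro power_mono) auto
      then show "M ^ D \<le> b ^ (D * M)" by (simp add: mult.commute flip: power_mult)
    qed auto
    finally have "real (card G) \<le> real ((D + 1) * (card I ^ D * b ^ (D * M)))"
      by (simp only: of_nat_le_iff)
    then show ?thesis by (simp only: of_nat_mult of_nat_power mult.assoc)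
  qed
  have "C * x ^ (n + L) < \<bar>\<Sum>h\<in>G. real_of_int (c (fst h)) * x ^ (J h + e h)\<bar>"
  proof (rule isolated_exponent_lower_bound[OF xx finG \<open>h0 \<in> G\<close>])
    show "e h0 = n" by (simp add: h0_def e_def n_def)
    show "e h + L < n \<or> e h = n \<or> n + L < e h" if "h \<in> G" for h
    proof -
      have "\<bar>int (e h) - int n\<bar> \<le> int L \<Longrightarrow> e h = n"
        using near[of "fst h" "snd h"] that by simp
      then show ?thesis by linarith
    qed
    show "J h \<le> D * M" if "h \<in> G" for h
    proof -
      obtain k g where h: "h = (k, g)" by (cases h)
      have "(\<Sum>l<k. snd (g l)) \<le> (\<Sum>l<k. M)"
        using mem(2)[of k g] that unfolding h by (intro sum_mono less_imp_le) simp
      also have "\<dots> \<le> D * M" using that unfolding h G_def by simp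
      finally show ?thesis by (simp add: h J_def)
    qed
    show "\<bar>real_of_int (c (fst h))\<bar> \<le> K" if "h \<in> G" for h
    proof -
      have "fst h \<in> {..D}" using that unfolding G_def by (metis SigmaD1 prod.collapse)
      then show ?thesis
        unfolding K_def by (rule member_le_sum) simp_all
    qed
    show "c D \<noteq> 0" using P(2) c[of D] by (auto simp: D_def)
    \<comment> \<open>Tuples reaching \<open>n\<close> have full length \<open>D\<close>, so all of
      them carry the leading coefficient of \<open>P\<close>.\<close>
    show "c (fst h) = c D" if "h \<in> G" "e h = n" for h
      using near[of "fst h" "snd h"] that by simp
    show "(C + 2 * K * real (card G)) * real b ^ (D * M) < real b ^ L"
    proof -
      have b1: "1 \<le> real b" using b by simp
      have "C * 1 \<le> C * real b ^ (D * M)"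
        using b1 C0 by (intro mult_left_mono one_le_power)
      moreover have "2 * K * real (card G) \<le>
          2 * K * (real (D + 1) * real (card I) ^ D * real b ^ (D * M))"
        using K0 card_G by (intro mult_left_mono) simp_all
      ultimately have "C + 2 * K * real (card G) \<le>
          C * real b ^ (D * M) + 2 * K * (real (D + 1) * real (card I) ^ D * real b ^ (D * M))"
        by linarith
      also have "\<dots> = W * real b ^ (D * M)" by (simp only: W_def distrib_right mult.assoc)
      finally have "(C + 2 * K * real (card G)) * real b ^ (D * M)
          \<le> W * real b ^ (D * M) * real b ^ (D * M)"
        using b1 by (intro mult_right_mono) auto
      also have "\<dots> < real b ^ Q * real b ^ (D * M) * real b ^ (D * M)"
        using Q b1 by (intro mult_strict_right_mono) auto
      also have "\<dots> = real b ^ (Q + 2 * (D * M))" by (simp only: mult_2 power_add mult.assoc)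
      also have "\<dots> \<le> real b ^ L" using QL b1 by (intro power_increasing) auto
      finally show ?thesis .
    qed
  qed (use C0 Ln in auto)
  with small PF show False by simp
qed

section \<open>Means of functions of the residue and the valuation\<close>

text \<open>Any \<open>m\<close> consecutive integers contain the residue \<open>r\<close> exactly
  once, so removing \<open>m\<close> from \<open>n\<close> changes both terms by 1. For
  \<open>n < m\<close> both lie between 0 and 1.\<close>

lemma card_residue_class_approx:
  fixes m n r :: nat
  assumes "r < m"
  shows "\<bar>real (card {k \<in> {1..n}. k mod m = r}) - real n / real m\<bar> \<le> 1"
proof -
  have m: "m > 0" using assms by simp
  have step: "card {k \<in> {1..n + m}. k mod m = r} = Suc (card {k \<in> {1..n}. k mod m = r})" for n
  proof -
    \<comment> \<open>Adding \<open>m\<close> before subtracting the residue of \<open>n + 1\<close>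
      prevents truncation of the natural number subtraction.\<close>
    define k0 where "k0 = n + 1 + ((r + m - (n + 1) mod m) mod m)"
    have "{k \<in> {n + 1..n + m}. k mod m = r} = {k0}"
    proof -
      have "k0 mod m = ((n + 1) mod m + (r + m - (n + 1) mod m)) mod m"
        unfolding k0_def by (simp only: mod_add_left_eq mod_add_right_eq)
      also have "(n + 1) mod m + (r + m - (n + 1) mod m) = r + m"
        using mod_less_divisor[OF m, of "n + 1"] by simp
      finally have k0: "k0 mod m = r" using assms by simp
      have "k0 \<in> {n + 1..n + m}"
        using mod_less_divisor[OF m, of "r + m - (n + 1) mod m"] by (simp add: k0_def)
      moreover have "k = k0" if "k \<in> {n + 1..n + m}" "k mod m = r" for k
      proof -
        have "[k = k0] (mod m)" using that(2) k0 by (simp add: cong_def)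
        then have "[int k = int k0] (mod int m)" by (simp add: cong_int_iff)
        then have "int m dvd int k - int k0" by (simp add: cong_iff_dvd_diff)
        moreover have "\<bar>int k - int k0\<bar> < int m" using that(1) \<open>k0 \<in> _\<close> by auto
        ultimately have "\<not> 0 < \<bar>int k - int k0\<bar>"
          by (metis dvd_abs_iff zdvd_not_zless)
        then show ?thesis by simp
      qed
      ultimately show ?thesis using k0 by blast
    qed
    moreover have "{k \<in> {1..n + m}. k mod m = r} =
        {k \<in> {1..n}. k mod m = r} \<union> {k \<in> {n + 1..n + m}. k mod m = r}"
      by auto
    ultimately have "{k \<in> {1..n + m}. k mod m = r} = insert k0 {k \<in> {1..n}. k mod m = r}"
      by simp
    moreover have "k0 \<notin> {k \<in> {1..n}. k mod m = r}" by (simp add: k0_def)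
    ultimately show ?thesis by simp
  qed
  show ?thesis
  proof (induction n rule: less_induct)
    case (less n)
    show ?case
    proof (cases "n < m")
      case True
      have "card {k \<in> {1..n}. k mod m = r} \<le> card {r}"
        using True by (intro card_mono) auto
      then have "real (card {k \<in> {1..n}. k mod m = r}) \<le> 1" by simp
      moreover have "0 \<le> real n / real m" "real n / real m \<le> 1" using True by auto
      ultimately show ?thesis by linarith
    next
      case False
      then have "real n / real m = real (n - m) / real m + 1"
        using m by (simp add: field_simps of_nat_diff)
      then show ?thesis using less[of "n - m"] step[of "n - m"] False m by simp
    qed
  qed
qed

text \<open>By the Chinese remainder theorem the two conditions cut out a single residue class
  modulo \<open>\<omega> * q\<close>.\<close>

lemma card_residue_and_multiple_approx:
  fixes a \<omega> q n :: nat
  assumes "coprime \<omega> q" "a < \<omega>" "q > 0"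
  shows "\<bar>real (card {k \<in> {1..n}. k mod \<omega> = a \<and> q dvd k}) - real n / (real \<omega> * real q)\<bar> \<le> 1"
proof -
  obtain z where z: "[z = a] (mod \<omega>)" "[z = 0] (mod q)"
    using binary_chinese_remainder_nat[OF assms(1)] by blast
  have "k mod \<omega> = a \<and> q dvd k \<longleftrightarrow> k mod (\<omega> * q) = z mod (\<omega> * q)" for k
  proof -
    have "k mod (\<omega> * q) = z mod (\<omega> * q) \<longleftrightarrow> [k = z] (mod \<omega>) \<and> [k = z] (mod q)"
      using assms(1) by (metis cong_def coprime_cong_mult_nat cong_modulus_mult_nat
          mult.commute)
    also have "\<dots> \<longleftrightarrow> [k = a] (mod \<omega>) \<and> [k = 0] (mod q)"
      using z by (metis cong_sym cong_trans)
    finally show ?thesis using assms(2) by (simp add: cong_def mod_eq_0_iff_dvd)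
  qed
  then show ?thesis
    using card_residue_class_approx[of "z mod (\<omega> * q)" "\<omega> * q" n] assms by simp
qed

text \<open>For each residue \<open>a\<close> and power \<open>p ^ j\<close> the count is off by at
  most 1, weighted by the increment \<open>d a j\<close>. Monotonicity bounds the total variation of
  these increments by 2, so each of the \<open>\<omega>\<close> residues contributes an error of at
  most 2, uniformly in \<open>n\<close>.\<close>

lemma sum_residue_valuation_approx:
  fixes p \<omega> n :: nat and f :: "nat \<Rightarrow> nat \<Rightarrow> real"
  assumes p: "p \<ge> 2" and \<omega>: "\<omega> \<ge> 1" "coprime \<omega> p"
    and f: "\<And>a j. 0 \<le> f a j" "\<And>a j. f a j \<le> 1" "\<And>a j. f a (Suc j) \<le> f a j"
  shows "\<bar>(\<Sum>k=1..n. f (k mod \<omega>) (multiplicity p k)) -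
           real n * ((real p - 1) / real \<omega> * (\<Sum>a<\<omega>. \<Sum>j. (1 / real p) ^ Suc j * f a j))\<bar>
         \<le> 2 * real \<omega>"
proof -
  define y where "y = 1 / real p"
  have y: "0 < y" "y < 1" using p by (auto simp: y_def)
  \<comment> \<open>telescoping over the powers of \<open>p\<close> dividing \<open>k\<close> replaces the condition that the valuation
      equals \<open>j\<close> by divisibility by \<open>p\<^sup>j\<close>, and makes the errors absolutely summable\<close>
  define d where "d = (\<lambda>a j. f a j - (if j = 0 then 0 else f a (j - 1)))"
  \<comment> \<open>The first increment is \<open>f a 0\<close>; all later ones are non-positive,
    and their absolute values telescope to \<open>f a 0 - lim (f a)\<close>.\<close>
  have abs_d: "(\<lambda>j. \<bar>d a j\<bar>) sums (2 * f a 0 - lim (f a))" and lim_f: "0 \<le> lim (f a)" for a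
  proof -
    have dec: "decseq (f a)" using f(3) by (simp add: decseq_Suc_iff)
    have "\<forall>i. 0 \<le> f a i" using f(1) by simp
    then obtain l where l: "f a \<longlonglongrightarrow> l"
      by (rule decseq_convergent[OF dec])
    have "(\<lambda>j. f a j - f a (Suc j)) sums (f a 0 - l)"
      by (rule telescope_sums'[OF l])
    moreover have "f a j - f a (Suc j) = \<bar>d a (Suc j)\<bar>" for j
      using f(3)[of a j] by (simp add: d_def)
    ultimately have "(\<lambda>j. \<bar>d a (Suc j)\<bar>) sums (f a 0 - l)" by simp
    then have "(\<lambda>j. \<bar>d a j\<bar>) sums (f a 0 - l + \<bar>d a 0\<bar>)" by (rule sums_Suc)
    then show "(\<lambda>j. \<bar>d a j\<bar>) sums (2 * f a 0 - lim (f a))"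
      using f(1)[of a 0] limI[OF l] by (simp add: d_def)
    show "0 \<le> lim (f a)" using LIMSEQ_le_const[OF l, of 0] f(1) limI[OF l] by auto
  qed
  have abs_d_le: "(\<Sum>j. \<bar>d a j\<bar>) \<le> 2" for a
    using sums_unique[OF abs_d[of a]] lim_f[of a] f(2)[of a 0] by simp
  have sum_d: "(\<Sum>j\<le>v. d a j) = f a v" for a v
    by (induction v) (auto simp: d_def)
  define N where "N = (\<lambda>a j. card {k \<in> {1..n}. k mod \<omega> = a \<and> p ^ j dvd k})"
  \<comment> \<open>No \<open>k\<close> in \<open>{1..n}\<close> is divisible by
    \<open>p ^ j\<close> once \<open>j \<ge> n\<close>, because \<open>p ^ j > j\<close>. Finite
    sums over \<open>j < n\<close> may thus be written as series.\<close>
  have N0: "N a j = 0" if "j \<ge> n" for a j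
  proof -
    have "\<not> p ^ j dvd k" if "k \<in> {1..n}" for k
    proof
      assume "p ^ j dvd k"
      then have "p ^ j \<le> k" using that by (intro dvd_imp_le) auto
      moreover have "j < 2 ^ j" by (rule less_exp)
      moreover have "(2 :: nat) ^ j \<le> p ^ j" using p by (intro power_mono) auto
      moreover have "k \<le> n" using that by simp
      ultimately show False using \<open>j \<ge> n\<close> by linarith
    qed
    then have "{k \<in> {1..n}. k mod \<omega> = a \<and> p ^ j dvd k} = {}" by auto
    then show ?thesis by (simp add: N_def)
  qed
  have N: "\<bar>real (N a j) - real n / (real \<omega> * real p ^ j)\<bar> \<le> 1" if "a < \<omega>" for a j
    using card_residue_and_multiple_approx[of \<omega> "p ^ j" a n] \<omega> p that by (simp add: N_def)
  have "(\<Sum>k=1..n. f (k mod \<omega>) (multiplicity p k)) =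
      (\<Sum>k=1..n. \<Sum>a<\<omega>. \<Sum>j<n. of_bool (k mod \<omega> = a \<and> p ^ j dvd k) * d a j)"
  proof (rule sum.cong)
    fix k assume k: "k \<in> {1..n}"
    have dvd: "p ^ j dvd k \<longleftrightarrow> j \<le> multiplicity p k" for j
      using k p by (intro power_dvd_iff_le_multiplicity) auto
    have "multiplicity p k < n"
    proof -
      have "multiplicity p k < 2 ^ multiplicity p k" by (rule less_exp)
      also have "\<dots> \<le> p ^ multiplicity p k" using p by (intro power_mono) auto
      also have "\<dots> \<le> k" using k by (intro dvd_imp_le multiplicity_dvd) auto
      finally show ?thesis using k by simp
    qed
    then have "{j. j < n \<and> j \<le> multiplicity p k} = {..multiplicity p k}" by auto
    moreover have "(\<Sum>j<n. of_bool (p ^ j dvd k) * d (k mod \<omega>) j) =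
        (\<Sum>j | j < n \<and> j \<le> multiplicity p k. d (k mod \<omega>) j)"
      unfolding dvd by (intro sum.mono_neutral_cong_right) auto
    ultimately have "f (k mod \<omega>) (multiplicity p k) =
        (\<Sum>j<n. of_bool (p ^ j dvd k) * d (k mod \<omega>) j)"
      by (simp add: sum_d)
    also have "\<dots> = (\<Sum>a<\<omega>. if a = k mod \<omega> then \<Sum>j<n. of_bool (p ^ j dvd k) * d a j else 0)"
      using \<omega> by (subst sum.delta) auto
    also have "\<dots> = (\<Sum>a<\<omega>. \<Sum>j<n. of_bool (k mod \<omega> = a \<and> p ^ j dvd k) * d a j)"
      by (intro sum.cong) auto
    finally show "f (k mod \<omega>) (multiplicity p k) =
        (\<Sum>a<\<omega>. \<Sum>j<n. of_bool (k mod \<omega> = a \<and> p ^ j dvd k) * d a j)" .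
  qed simp
  also have "\<dots> = (\<Sum>a<\<omega>. \<Sum>j<n. \<Sum>k=1..n. of_bool (k mod \<omega> = a \<and> p ^ j dvd k) * d a j)"
    by (subst sum.swap, rule sum.cong[OF refl], rule sum.swap)
  also have "\<dots> = (\<Sum>a<\<omega>. \<Sum>j<n. real (N a j) * d a j)"
    unfolding sum_distrib_right[symmetric] N_def by (simp add: Int_def flip: of_nat_sum)
  also have "\<dots> = (\<Sum>a<\<omega>. \<Sum>j. real (N a j) * d a j)"
    using N0 by (intro sum.cong refl suminf_finite[symmetric]) auto
  finally have lhs: "(\<Sum>k=1..n. f (k mod \<omega>) (multiplicity p k)) =
      (\<Sum>a<\<omega>. \<Sum>j. real (N a j) * d a j)" .
  \<comment> \<open>Summation by parts turns the series of \<open>y ^ j * d a j\<close> into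
    \<open>1 - y\<close> times that of \<open>y ^ j * f a j\<close>, and
    \<open>1 - y = (p - 1) * y\<close>.\<close>
  have mean: "(\<lambda>j. real n / (real \<omega> * real p ^ j) * d a j) sums
      (real n * ((real p - 1) / real \<omega> * (\<Sum>j. y ^ Suc j * f a j)))" for a
  proof -
    have sm: "summable (\<lambda>j. y ^ j * f a j)"
    proof (rule summable_comparison_test')
      show "summable (\<lambda>j. y ^ j)" using y by (simp add: summable_geometric)
      show "norm (y ^ j * f a j) \<le> y ^ j" if "j \<ge> 0" for j
        using y f(1,2)[of a j] by (simp add: abs_mult mult_left_le)
    qed
    define g where "g = (\<Sum>j. y ^ j * f a j)"
    have g: "(\<lambda>j. y ^ j * f a j) sums g" using sm by (simp add: g_def summable_sums)
    then have "(\<lambda>j. y * (y ^ j * f a j)) sums (y * g)" by (rule sums_mult)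
    then have "(\<lambda>j. y ^ Suc j * f a j) sums (y * g)" by (simp add: mult.assoc)
    then have "(\<lambda>j. if j = 0 then 0 else y ^ j * f a (j - 1)) sums (y * g)" and
      yg: "(\<Sum>j. y ^ Suc j * f a j) = y * g"
      using sums_Suc_iff[of "\<lambda>j. if j = 0 then 0 else y ^ j * f a (j - 1)" "y * g"]
      by (simp_all add: sums_iff)
    from sums_diff[OF g this(1)]
    have "(\<lambda>j. y ^ j * d a j) sums (g - y * g)"
      by (rule sums_cong[THEN iffD1, rotated]) (auto simp: d_def algebra_simps)
    then have "(\<lambda>j. real n / real \<omega> * (y ^ j * d a j)) sums (real n / real \<omega> * (g - y * g))"
      by (rule sums_mult)
    moreover have "real n / real \<omega> * (y ^ j * d a j) = real n / (real \<omega> * real p ^ j) * d a j" for j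
      by (simp add: y_def power_one_over)
    moreover have "g - y * g = (real p - 1) * (y * g)"
      using p by (simp add: y_def field_simps)
    then have "real n / real \<omega> * (g - y * g) = real n * ((real p - 1) / real \<omega> * (y * g))"
      by simp
    ultimately show ?thesis
      unfolding yg by (simp only:)
  qed
  have sm_N: "summable (\<lambda>j. real (N a j) * d a j)" for a
    using N0 by (intro summable_finite[of "{..<n}"]) auto
  have "\<bar>(\<Sum>j. real (N a j) * d a j) -
      real n * ((real p - 1) / real \<omega> * (\<Sum>j. y ^ Suc j * f a j))\<bar> \<le> 2" if a: "a < \<omega>" for a
  proof -
    have "(\<lambda>j. real (N a j) * d a j - real n / (real \<omega> * real p ^ j) * d a j) sums
        ((\<Sum>j. real (N a j) * d a j) -
          real n * ((real p - 1) / real \<omega> * (\<Sum>j. y ^ Suc j * f a j)))"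
      by (intro sums_diff mean summable_sums sm_N)
    then have *: "(\<lambda>j. (real (N a j) - real n / (real \<omega> * real p ^ j)) * d a j) sums
        ((\<Sum>j. real (N a j) * d a j) -
          real n * ((real p - 1) / real \<omega> * (\<Sum>j. y ^ Suc j * f a j)))"
      by (simp add: left_diff_distrib)
    have le: "\<bar>(real (N a j) - real n / (real \<omega> * real p ^ j)) * d a j\<bar> \<le> \<bar>d a j\<bar>" for j
      using N[OF a, of j] by (simp add: abs_mult mult_left_le_one_le)
    have "norm (\<Sum>j. (real (N a j) - real n / (real \<omega> * real p ^ j)) * d a j) \<le> (\<Sum>j. \<bar>d a j\<bar>)"
      using abs_d by (intro norm_suminf_le) (auto simp: sums_iff le)
    then show ?thesis using sums_unique[OF *] abs_d_le[of a] by simp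
  qed
  then have "(\<Sum>a<\<omega>. \<bar>(\<Sum>j. real (N a j) * d a j) -
      real n * ((real p - 1) / real \<omega> * (\<Sum>j. y ^ Suc j * f a j))\<bar>) \<le> (\<Sum>a<\<omega>. 2)"
    by (intro sum_mono) auto
  moreover have "(\<Sum>a<\<omega>. 2 :: real) = 2 * real \<omega>" by simp
  ultimately have "\<bar>\<Sum>a<\<omega>. (\<Sum>j. real (N a j) * d a j) -
      real n * ((real p - 1) / real \<omega> * (\<Sum>j. y ^ Suc j * f a j))\<bar> \<le> 2 * real \<omega>"
    using sum_abs[of "\<lambda>a. (\<Sum>j. real (N a j) * d a j) -
      real n * ((real p - 1) / real \<omega> * (\<Sum>j. y ^ Suc j * f a j))" "{..<\<omega>}"] by linarith
  then show ?thesis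
    unfolding lhs by (simp add: sum_subtractf sum_distrib_left y_def)
qed

text \<open>Replacing the integer part of \<open>x\<close> by \<open>x\<close> costs at most
  \<open>\<bar>B\<bar>\<close>, so the total error stays bounded and vanishes after division by
  \<open>x\<close>.\<close>

lemma cesaro_mean_of_bounded_error:
  fixes S :: "nat \<Rightarrow> real"
  assumes "\<And>n. \<bar>S n - real n * B\<bar> \<le> C"
  shows "((\<lambda>x :: real. (1 / x) * S (nat \<lfloor>x\<rfloor>)) \<longlongrightarrow> B) at_top"
proof (rule LIM_zero_cancel, rule Lim_null_comparison)
  show "((\<lambda>x :: real. (C + \<bar>B\<bar>) * inverse x) \<longlongrightarrow> 0) at_top"
    by (intro tendsto_mult_right_zero tendsto_inverse_0_at_top filterlim_ident)
  show "\<forall>\<^sub>F x in at_top. norm (1 / x * S (nat \<lfloor>x\<rfloor>) - B) \<le> (C + \<bar>B\<bar>) * inverse x"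
    using eventually_gt_at_top[of 0]
  proof eventually_elim
    fix x :: real assume x: "x > 0"
    define n where "n = nat \<lfloor>x\<rfloor>"
    have "\<bar>real n - x\<bar> \<le> 1" using x unfolding n_def by linarith
    then have "\<bar>(real n - x) * B\<bar> \<le> \<bar>B\<bar>" by (simp add: abs_mult mult_left_le_one_le)
    moreover have "\<bar>S n - x * B\<bar> \<le> \<bar>S n - real n * B\<bar> + \<bar>(real n - x) * B\<bar>"
      by (simp add: left_diff_distrib)
    ultimately have "\<bar>S n - x * B\<bar> \<le> C + \<bar>B\<bar>" using assms[of n] by linarith
    moreover have "1 / x * S n - B = (S n - x * B) * inverse x" using x by (simp add: field_simps)
    ultimately show "norm (1 / x * S (nat \<lfloor>x\<rfloor>) - B) \<le> (C + \<bar>B\<bar>) * inverse x"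
      using x by (simp add: abs_mult flip: n_def)
  qed
qed

section \<open>Rationality of the zeta function\<close>

lemma dyn_zeta_nth_0: "fps_nth (dyn_zeta s) 0 = 1"
  by (simp add: dyn_zeta_def)

lemma fps_deriv_dyn_zeta:
  "fps_deriv (dyn_zeta s) = dyn_zeta s * Abs_fps (\<lambda>n. of_nat (s (Suc n)))"
proof -
  define g :: "complex fps" where "g = Abs_fps (\<lambda>k. if k = 0 then 0 else of_nat (s k) / of_nat k)"
  have "fps_deriv g = Abs_fps (\<lambda>n. of_nat (s (Suc n)))"
    by (rule fps_ext) (simp add: g_def del: of_nat_Suc)
  moreover have "fps_deriv (dyn_zeta s) = dyn_zeta s * fps_deriv g"
    by (simp add: dyn_zeta_def fps_compose_deriv flip: g_def) (simp add: g_def fps_compose_deriv)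
  ultimately show ?thesis by simp
qed

text \<open>If the zeta function is \<open>P / Q\<close>, its logarithmic derivative
  \<open>g\<close> satisfies \<open>Q * P * g = Q * P' - Q' * P\<close>. The right side is a
  polynomial, so the coefficients of the product vanish beyond its degree.\<close>

lemma dyn_zeta_rational_imp_recurrence:
  assumes "fps_rational (dyn_zeta s)"
  obtains W :: "complex poly" and n0 where "W \<noteq> 0"
    "\<And>n. n \<ge> n0 \<Longrightarrow> (\<Sum>i\<le>n. coeff W i * of_nat (s (Suc (n - i)))) = 0"
proof -
  define F where "F = dyn_zeta s"
  define g :: "complex fps" where "g = Abs_fps (\<lambda>n. of_nat (s (Suc n)))"
  obtain P Q where Q: "Q \<noteq> 0" and QF: "fps_of_poly Q * F = fps_of_poly P"
    using assms unfolding fps_rational_def F_def by blast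
  have F': "fps_deriv F = F * g" by (simp add: F_def g_def fps_deriv_dyn_zeta)
  have "F \<noteq> 0" using dyn_zeta_nth_0[of s] by (auto simp: F_def)
  with Q QF have "P \<noteq> 0" by auto
  have "fps_deriv (fps_of_poly P) = fps_deriv (fps_of_poly Q) * F + fps_of_poly Q * (F * g)"
    unfolding QF[symmetric] by (simp add: F' add.commute)
  then have "fps_of_poly Q * fps_deriv (fps_of_poly P) =
      fps_deriv (fps_of_poly Q) * (fps_of_poly Q * F) + fps_of_poly Q * (fps_of_poly Q * F) * g"
    by (simp add: algebra_simps)
  then have "fps_of_poly (Q * P) * g = fps_of_poly (Q * pderiv P - pderiv Q * P)"
    by (simp add: QF fps_of_poly_mult fps_of_poly_diff fps_of_poly_pderiv)
  then have coeff_eq: "fps_nth (fps_of_poly (Q * P) * g) n = coeff (Q * pderiv P - pderiv Q * P) n" for n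
    by (simp add: fps_of_poly_nth)
  show ?thesis
  proof
    show "Q * P \<noteq> 0" using Q \<open>P \<noteq> 0\<close> by simp
    fix n assume n: "n \<ge> Suc (Polynomial.degree (Q * pderiv P - pderiv Q * P))"
    have "(\<Sum>i\<le>n. coeff (Q * P) i * of_nat (s (Suc (n - i)))) = fps_nth (fps_of_poly (Q * P) * g) n"
      by (simp add: fps_mult_nth g_def fps_of_poly_nth atLeast0AtMost)
    also have "\<dots> = 0" unfolding coeff_eq using n by (intro coeff_eq_0) simp
    finally show "(\<Sum>i\<le>n. coeff (Q * P) i * of_nat (s (Suc (n - i)))) = 0" .
  qed
qed

text \<open>After division by \<open>q ^ K\<close> the recurrence has constant coefficients in
  \<open>u\<close>. Solving it for the term of the lowest nonzero coefficient of \<open>W\<close>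
  expresses \<open>u K\<close> through at most \<open>d\<close> preceding values.\<close>

lemma recurrence_window:
  fixes u :: "nat \<Rightarrow> real" and q :: nat and W :: "complex poly"
  assumes q: "q > 0" and W: "W \<noteq> 0"
    and rec: "\<And>n. n \<ge> n0 \<Longrightarrow> (\<Sum>i\<le>n. coeff W i * of_nat (s (Suc (n - i)))) = 0"
    and u: "\<And>k. k \<ge> 1 \<Longrightarrow> real (s k) = u k * real q ^ k"
  shows "\<exists>d N. \<forall>K\<ge>N. \<forall>K'\<ge>N. (\<forall>e\<in>{1..d}. u (K - e) = u (K' - e)) \<longrightarrow> u K = u K'"
proof -
  define i0 where "i0 = (LEAST i. coeff W i \<noteq> 0)"
  define d where "d = Polynomial.degree W"
  have "\<exists>i. coeff W i \<noteq> 0" using W by (meson leading_coeff_0_iff)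
  then have "coeff W i0 \<noteq> 0" unfolding i0_def by (rule LeastI_ex)
  moreover have "coeff W i = 0" if "i < i0" for i
    using not_less_Least that unfolding i0_def by blast
  ultimately have i0: "coeff W i0 \<noteq> 0" "\<And>i. i < i0 \<Longrightarrow> coeff W i = 0" by auto
  have i0d: "i0 \<le> d" unfolding d_def using i0(1) by (rule le_degree)
  define Z where "Z = (\<lambda>K. \<Sum>i\<in>{i0<..d}. coeff W i * of_real (u (K - (i - i0))) / of_nat q ^ (i - i0))"
  have key: "coeff W i0 * of_real (u K) = - Z K" if K: "K \<ge> n0 + d + 1" for K
  proof -
    \<comment> \<open>With this shift the summand of index \<open>i0\<close> involves exactly
      \<open>s K\<close>.\<close>
    define n where "n = K + i0 - 1"
    have "n \<ge> n0" "d \<le> n" using K by (auto simp: n_def)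
    have summand: "coeff W i * of_nat (s (Suc (n - i))) =
        of_nat q ^ K * (coeff W i * of_real (u (K - (i - i0))) / of_nat q ^ (i - i0))"
      if i: "i0 \<le> i" "i \<le> d" for i
    proof -
      have idx: "Suc (n - i) = K - (i - i0)" using i K by (simp add: n_def)
      have "K - (i - i0) \<ge> 1" using i K by simp
      then have "of_real (real (s (Suc (n - i)))) = (of_real (u (K - (i - i0)) * real q ^ (K - (i - i0))) :: complex)"
        unfolding idx by (simp only: u)
      then have "of_nat (s (Suc (n - i))) = (of_real (u (K - (i - i0))) * of_nat q ^ (K - (i - i0)) :: complex)"
        by simp
      moreover have "(of_nat q :: complex) ^ (K - (i - i0)) = of_nat q ^ K / of_nat q ^ (i - i0)"
        using q i K by (intro power_diff) auto
      ultimately show ?thesis by simp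
    qed
    have "0 = (\<Sum>i\<le>n. coeff W i * of_nat (s (Suc (n - i))))"
      using rec[OF \<open>n \<ge> n0\<close>] by simp
    also have "\<dots> = (\<Sum>i\<in>{i0..d}. coeff W i * of_nat (s (Suc (n - i))))"
      using i0(2) \<open>d \<le> n\<close> by (intro sum.mono_neutral_right) (auto simp: d_def coeff_eq_0 not_le)
    also have "\<dots> = (\<Sum>i\<in>{i0..d}. of_nat q ^ K * (coeff W i * of_real (u (K - (i - i0))) / of_nat q ^ (i - i0)))"
      by (intro sum.cong summand) auto
    also have "\<dots> = of_nat q ^ K * (\<Sum>i\<in>{i0..d}. coeff W i * of_real (u (K - (i - i0))) / of_nat q ^ (i - i0))"
      by (simp only: sum_distrib_left)
    also have "(\<Sum>i\<in>{i0..d}. coeff W i * of_real (u (K - (i - i0))) / of_nat q ^ (i - i0)) =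
        coeff W i0 * of_real (u K) + Z K"
      unfolding Z_def using i0d by (subst sum.head) (auto)
    finally show ?thesis using q by (simp add: eq_neg_iff_add_eq_0)
  qed
  show ?thesis
  proof (intro exI allI impI)
    fix K K' assume K: "K \<ge> n0 + d + 1" "K' \<ge> n0 + d + 1"
      and eq: "\<forall>e\<in>{1..d}. u (K - e) = u (K' - e)"
    have "Z K = Z K'" unfolding Z_def
    proof (intro sum.cong refl)
      fix i assume "i \<in> {i0<..d}"
      then have "i - i0 \<in> {1..d}" by auto
      then show "coeff W i * of_real (u (K - (i - i0))) / of_nat q ^ (i - i0) =
          coeff W i * of_real (u (K' - (i - i0))) / of_nat q ^ (i - i0)"
        using eq by simp
    qed
    then have "coeff W i0 * of_real (u K) = coeff W i0 * (of_real (u K') :: complex)"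
      using key K by simp
    then show "u K = u K'" using i0(1) by simp
  qed
qed

text \<open>The bound \<open>e < p ^ J\<close> forces the valuation of \<open>e\<close> below
  \<open>J\<close>, so \<open>K\<close> is divisible by a higher power of \<open>p\<close> than
  \<open>e\<close> and does not affect the valuation of the difference.\<close>

lemma multiplicity_diff_less:
  fixes p K e J :: nat
  assumes "p \<ge> 2" "p ^ J dvd K" "1 \<le> e" "e < p ^ J" "e \<le> K"
  shows "multiplicity p (K - e) = multiplicity p e"
proof (rule multiplicity_eqI)
  define v where "v = multiplicity p e"
  have "p ^ v dvd e" "\<not> p ^ Suc v dvd e"
    using assms by (auto simp: v_def multiplicity_dvd power_dvd_iff_le_multiplicity simp del: power_Suc)
  have "v < J"
  proof (rule ccontr)
    assume "\<not> v < J"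
    then have "p ^ J dvd e" using \<open>p ^ v dvd e\<close> by (meson dvd_trans le_imp_power_dvd not_less)
    then show False using assms by (auto dest: dvd_imp_le)
  qed
  then have "p ^ Suc v dvd K" by (meson assms(2) Suc_leI dvd_trans le_imp_power_dvd)
  then have "p ^ v dvd K" by (meson dvd_trans le_imp_power_dvd le_Suc_eq le_refl)
  then show "p ^ v dvd K - e" using \<open>p ^ v dvd e\<close> by (rule dvd_diff_nat)
  show "\<not> p ^ Suc v dvd K - e"
    using \<open>\<not> p ^ Suc v dvd e\<close> \<open>p ^ Suc v dvd K\<close> assms(5) dvd_diffD1 by blast
qed

text \<open>Being congruent to \<open>p ^ J\<close> modulo \<open>p ^ Suc J\<close> fixes the
  valuation as exactly \<open>J\<close>. The Chinese remainder theorem combines this with the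
  residue modulo \<open>\<omega>\<close>, and adding multiples of the joint modulus makes
  \<open>K\<close> large.\<close>

lemma exists_residue_valuation:
  fixes p \<omega> a J N :: nat
  assumes "p \<ge> 2" "coprime \<omega> p" "a < \<omega>"
  obtains K where "K \<ge> N" "K mod \<omega> = a" "multiplicity p K = J"
proof -
  have "coprime \<omega> (p ^ Suc J)" using assms by simp
  then obtain z where z: "[z = a] (mod \<omega>)" "[z = p ^ J] (mod p ^ Suc J)"
    using binary_chinese_remainder_nat by blast
  define K where "K = z + N * (\<omega> * p ^ Suc J)"
  have "\<omega> * p ^ Suc J \<ge> 1" using assms by (simp add: Suc_le_eq)
  then have "N * 1 \<le> N * (\<omega> * p ^ Suc J)" by (intro mult_left_mono) auto
  then have "K \<ge> N" unfolding K_def by linarith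
  moreover have "K mod \<omega> = a"
  proof -
    have "K mod \<omega> = z mod \<omega>" unfolding K_def by (metis mod_mult_self1 mult.assoc mult.commute)
    then show ?thesis using z(1) assms(3) by (simp add: cong_def)
  qed
  moreover have "multiplicity p K = J"
  proof (rule multiplicity_eqI)
    have "K mod p ^ Suc J = z mod p ^ Suc J" unfolding K_def by (metis mod_mult_self1 mult.assoc)
    also have "\<dots> = p ^ J" using z(2) assms(1) by (simp add: cong_def)
    finally have K: "K mod p ^ Suc J = p ^ J" .
    have "p ^ J dvd K mod p ^ Suc J" unfolding K by simp
    then show "p ^ J dvd K" by (metis dvd_mod_imp_dvd le_imp_power_dvd le_Suc_eq le_refl)
    show "\<not> p ^ Suc J dvd K" using K assms(1) by (metis mod_eq_0_iff_dvd not_numeral_le_zero power_eq_0_iff)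
  qed
  ultimately show ?thesis by (rule that)
qed

text \<open>
  The window before an index with prescribed residue and high valuation does not depend on that
  valuation, so a recurrence forces the values at such indices to agree.
\<close>
lemma dyn_zeta_rational_imp_valuation_independent:
  fixes p \<omega> q :: nat and f :: "nat \<Rightarrow> nat \<Rightarrow> real"
  assumes rat: "fps_rational (dyn_zeta s)" and p: "p \<ge> 2" "coprime \<omega> p" and q: "q > 0"
    and s: "\<And>k. k \<ge> 1 \<Longrightarrow> real (s k) = f (k mod \<omega>) (multiplicity p k) * real q ^ k"
    and a: "a < \<omega>"
  shows "\<exists>J. f a J = f a (Suc J)"
proof -
  obtain W n0 where W: "W \<noteq> 0"
    "\<And>n. n \<ge> n0 \<Longrightarrow> (\<Sum>i\<le>n. coeff W i * of_nat (s (Suc (n - i)))) = (0 :: complex)"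
    using dyn_zeta_rational_imp_recurrence[OF rat] by blast
  define u where "u = (\<lambda>k. f (k mod \<omega>) (multiplicity p k))"
  have "real (s k) = u k * real q ^ k" if "k \<ge> 1" for k
    using s[OF that] by (simp add: u_def)
  from recurrence_window[OF q W this] obtain d N where
    window: "\<forall>K\<ge>N. \<forall>K'\<ge>N. (\<forall>e\<in>{1..d}. u (K - e) = u (K' - e)) \<longrightarrow> u K = u K'"
    by blast
  \<comment> \<open>All that matters is \<open>d < p ^ J\<close>, so that every offset in the window
    has valuation below \<open>J\<close>.\<close>
  define J where "J = d"
  have "d < 2 ^ d" by (rule less_exp)
  also have "(2 :: nat) ^ d \<le> p ^ J" unfolding J_def using p by (intro power_mono) auto
  finally have dJ: "d < p ^ J" .
  \<comment> \<open>The extra \<open>d\<close> in the lower bound keeps the subtractions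
    \<open>K - e\<close> from being truncated.\<close>
  obtain K where K: "K \<ge> N + d" "K mod \<omega> = a" "multiplicity p K = J"
    using exists_residue_valuation[OF p a] by blast
  obtain K' where K': "K' \<ge> N + d" "K' mod \<omega> = a" "multiplicity p K' = Suc J"
    using exists_residue_valuation[OF p a] by blast
  have "u K = u K'"
  proof (rule window[rule_format])
    fix e assume "e \<in> {1..d}"
    then have e: "1 \<le> e" "e \<le> d" by auto
    have "p ^ J dvd K" "p ^ J dvd K'"
      using K(3) K'(3) by (metis multiplicity_dvd, metis multiplicity_dvd' le_Suc_eq le_refl)
    then have "multiplicity p (K - e) = multiplicity p (K' - e)"
      using e dJ K(1) K'(1) p by (simp add: multiplicity_diff_less[of p J])
    moreover have "(K - e) mod \<omega> = (K' - e) mod \<omega>"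
    proof -
      have "[K = K'] (mod \<omega>)" using K(2) K'(2) by (simp add: cong_def)
      then have "[K - e = K' - e] (mod \<omega>)" using e K(1) K'(1) by (intro cong_diff_nat) auto
      then show ?thesis by (simp add: cong_def)
    qed
    ultimately show "u (K - e) = u (K' - e)" by (simp add: u_def)
  qed (use K K' in auto)
  then show ?thesis using K K' by (auto simp: u_def)
qed

text \<open>The zeta function is \<open>1 / (1 - q X)\<close>: its product with
  \<open>1 - q X\<close> has derivative 0 and constant term 1.\<close>

lemma dyn_zeta_geometric_rational:
  assumes "\<And>k. k \<ge> 1 \<Longrightarrow> s k = q ^ k"
  shows "fps_rational (dyn_zeta s)"
proof -
  define F where "F = dyn_zeta s"
  define Q :: "complex poly" where "Q = [:1, - of_nat q:]"
  define g :: "complex fps" where "g = Abs_fps (\<lambda>n. of_nat (s (Suc n)))"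
  have Q: "fps_of_poly Q = 1 - fps_const (of_nat q) * fps_X"
    by (simp add: Q_def fps_of_poly_pCons)
  have "g * (1 - fps_const (of_nat q) * fps_X) = fps_const (of_nat q)"
  proof (rule fps_ext)
    fix n
    have "g * (1 - fps_const (of_nat q) * fps_X) = g - fps_const (of_nat q) * (g * fps_X)"
      by (simp add: algebra_simps)
    then show "fps_nth (g * (1 - fps_const (of_nat q) * fps_X)) n = fps_nth (fps_const (of_nat q)) n"
      by (cases n) (simp_all add: g_def assms)
  qed
  then have gQ: "g * fps_of_poly Q = fps_const (of_nat q)" by (simp add: Q)
  have "fps_deriv (fps_of_poly Q * F) =
      F * (g * fps_of_poly Q) + fps_deriv (fps_of_poly Q) * F"
    by (simp add: F_def g_def fps_deriv_dyn_zeta mult_ac)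
  also have "fps_deriv (fps_of_poly Q) = fps_const (- of_nat q)" by (simp add: Q)
  also have "F * (g * fps_of_poly Q) + fps_const (- of_nat q) * F =
      F * (fps_const (of_nat q) + fps_const (- of_nat q))"
    unfolding gQ by (simp only: distrib_left mult.commute)
  also have "\<dots> = 0" by simp
  finally have "fps_of_poly Q * F = fps_const (fps_nth (fps_of_poly Q * F) 0)"
    by (simp only: fps_deriv_eq_0_iff)
  also have "\<dots> = fps_of_poly 1" by (simp add: Q F_def dyn_zeta_nth_0)
  finally have "fps_of_poly Q * F = fps_of_poly 1" .
  moreover have "Q \<noteq> 0" by (simp add: Q_def)
  ultimately show ?thesis unfolding fps_rational_def F_def by blast
qed

section \<open>The average of the normalised fixed point counts\<close>

text \<open>For \<open>\<alpha> \<noteq> 0\<close>, an annihilating polynomial of \<open>x\<close>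
  composed with the inverse affine map annihilates the image.\<close>

lemma algebraic_affine:
  fixes x \<alpha> \<beta> :: "'a :: field_char_0"
  assumes "algebraic x" "\<alpha> \<in> \<rat>" "\<beta> \<in> \<rat>"
  shows "algebraic (\<alpha> * x + \<beta>)"
proof (cases "\<alpha> = 0")
  case False
  obtain P where P: "\<forall>i. coeff P i \<in> \<rat>" "P \<noteq> 0" "poly P x = 0"
    using assms(1) unfolding algebraic_altdef by blast
  define q where "q = [:- \<beta> / \<alpha>, 1 / \<alpha>:]"
  show ?thesis
  proof (rule algebraicI')
    show "coeff (pcompose P q) i \<in> \<rat>" for i
    proof (rule coeff_pcompose_semiring_closed)
      show "coeff q i \<in> \<rat>" for i
        using assms(2,3) by (auto simp: q_def coeff_pCons split: nat.split)
    qed (use P(1) in auto)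
    show "pcompose P q \<noteq> 0"
      using P(2) False by (simp add: pcompose_eq_0_iff q_def)
    show "poly (pcompose P q) (\<alpha> * x + \<beta>) = 0"
      using P(3) False by (simp add: poly_pcompose q_def add_divide_distrib)
  qed
qed (use assms in \<open>auto intro: rat_imp_algebraic\<close>)

text \<open>The term with \<open>t k\<close> only lowers the logarithm, which gives the upper bound.
  Along \<open>k = p * i + 1\<close> the valuation is 0, so that term is bounded and disappears
  after division by \<open>k\<close>.\<close>

lemma growth_rate_eq:
  fixes p c T :: nat and s t :: "nat \<Rightarrow> nat"
  assumes p: "p \<ge> 2" and T: "\<And>k. t k \<le> T"
    and s: "\<And>k. k \<ge> 1 \<Longrightarrow>
      real (s k) = real p powr (real k * real c - real (t k) * real p ^ multiplicity p k)"
  shows "growth_rate s = real p ^ c"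
proof -
  define Z where "Z = (\<lambda>k. ereal (ln (real (s k)) / real k))"
  define l where "l = real c * ln (real p)"
  have lnp: "ln (real p) > 0" using p by simp
  have Z: "Z k = ereal (l - real (t k) * real p ^ multiplicity p k * ln (real p) / real k)"
    if "k \<ge> 1" for k
    using that p by (simp add: Z_def s ln_powr l_def field_simps)
  have "limsup Z \<le> ereal l"
  proof (rule Limsup_bounded)
    show "\<forall>\<^sub>F k in sequentially. Z k \<le> ereal l"
      using eventually_ge_at_top[of 1] by eventually_elim (use lnp in \<open>simp add: Z\<close>)
  qed
  moreover have "ereal l \<le> limsup Z"
  proof -
    define r where "r = (\<lambda>i. p * i + 1)"
    have mult_r: "multiplicity p (r i) = 0" for i
    proof (rule not_dvd_imp_multiplicity_0)
      have "p dvd r i \<longleftrightarrow> p dvd 1" unfolding r_def by (rule dvd_add_right_iff) simp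
      then show "\<not> p dvd r i" using p by simp
    qed
    have r: "strict_mono r" using p by (auto simp: strict_mono_def r_def)
    have "(\<lambda>i. l - real (t (r i)) * ln (real p) / real (r i)) \<longlonglongrightarrow> l - 0"
    proof (intro tendsto_diff tendsto_const, rule Lim_null_comparison)
      have "filterlim (\<lambda>i. real (r i)) at_top sequentially"
        using filterlim_compose[OF filterlim_real_sequentially filterlim_subseq[OF r]] .
      then have "(\<lambda>i. inverse (real (r i))) \<longlonglongrightarrow> 0"
        by (rule tendsto_inverse_0_at_top)
      then show "(\<lambda>i. real T * ln (real p) * inverse (real (r i))) \<longlonglongrightarrow> 0"
        by (rule tendsto_mult_right_zero)
      show "\<forall>\<^sub>F i in sequentially. norm (real (t (r i)) * ln (real p) / real (r i))
          \<le> real T * ln (real p) * inverse (real (r i))"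
        using lnp T by (intro always_eventually allI)
          (auto simp: divide_inverse intro!: mult_right_mono)
    qed
    moreover have "(Z \<circ> r) i = ereal (l - real (t (r i)) * ln (real p) / real (r i))" for i
    proof -
      have "r i \<ge> 1" by (simp add: r_def)
      from Z[OF this] show ?thesis by (simp add: mult_r)
    qed
    ultimately have "(Z \<circ> r) \<longlonglongrightarrow> ereal l" by (simp add: comp_def)
    then have "limsup (Z \<circ> r) = ereal l" by (intro lim_imp_Limsup) auto
    then show ?thesis using limsup_subseq_mono[OF r, of Z] by simp
  qed
  ultimately have "limsup Z = ereal l" by (rule antisym)
  then have "growth_rate s = exp l" by (simp add: growth_rate_def Z_def)
  also have "\<dots> = real p ^ c" using p by (simp add: l_def exp_of_nat_mult)
  finally show ?thesis .
qed

theorem proposition5p4: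
  fixes p c \<omega> :: nat and s t :: "nat \<Rightarrow> nat"
  assumes p: "prime p" "CARD('f :: {field, finite}) = p"
    and system:
      "(\<exists>\<sigma> :: 'f alg_closure ^ 'r \<Rightarrow> 'f alg_closure ^ 'r.
          vector_group_endo \<sigma> \<and> confined \<sigma> \<and> s = fix_count \<sigma>) \<or>
       (\<exists>\<sigma> :: (int \<Rightarrow> 'f ^ 'r) \<Rightarrow> (int \<Rightarrow> 'f ^ 'r).
          additive_cellular_automaton \<sigma> \<and> confined \<sigma> \<and> s = fix_count \<sigma>)"
    and period: "\<omega> \<ge> 1" "coprime \<omega> p" "\<And>k. k \<ge> 1 \<Longrightarrow> t (k + \<omega>) = t k" "t 0 = t \<omega>"
    and counts: "\<And>k. k \<ge> 1 \<Longrightarrow>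
      real (s k) = real p powr (real k * real c - real (t k) * inverse (padic_abs p k))"
  shows "\<exists>B :: real.
    ((\<lambda>x :: real. (1 / x) * (\<Sum>k = 1..nat \<lfloor>x\<rfloor>. real (s k) / growth_rate s ^ k))
       \<longlongrightarrow> B) at_top \<and>
    B = (real p - 1) / real \<omega> *
          (\<Sum>a = 0..\<omega> - 1. \<Sum>j. real p powr (- 1 - real j - real (t a) * real p ^ j)) \<and>
    (\<not> algebraic B \<or> B = 1) \<and>
    (B = 1 \<longleftrightarrow> fps_rational (dyn_zeta s)) \<and>
    (fps_rational (dyn_zeta s) \<longleftrightarrow> (\<forall>a<\<omega>. t a = 0))"
proof -
  have p2: "p \<ge> 2" using p(1) by (rule prime_ge_2_nat)
  define y where "y = 1 / real p"
  have y: "0 < y" "y < 1" using p2 by (auto simp: y_def)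
  have y_pow: "real p powr (- real k) = y ^ k" for k
    using p2 by (simp add: y_def powr_minus powr_realpow power_inverse divide_inverse)
  \<comment> \<open>This is the normalised count at indices of residue \<open>a\<close> and
    valuation \<open>j\<close>.\<close>
  define f where "f = (\<lambda>a j. y ^ (t a * p ^ j))"
  \<comment> \<open>Periodicity is given from index 1 on; the convention
    \<open>t 0 = t \<omega>\<close> extends it to index 0.\<close>
  have t_mult: "t (a + \<omega> * i) = t a" for a i
  proof (induction i)
    case (Suc i)
    show ?case
    proof (cases "a + \<omega> * i = 0")
      case True
      then show ?thesis using period(1,4) by simp
    next
      case False
      then have "a + \<omega> * i \<ge> 1" by linarith
      from period(3)[OF this] Suc show ?thesis by (simp add: add_ac)
    qed
  qed simp
  have t_mod: "t k = t (k mod \<omega>)" for k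
    using t_mult[of "k mod \<omega>" "k div \<omega>"] by (simp add: add.commute)
  define T where "T = Max (t ` {..<\<omega>})"
  have T: "t k \<le> T" for k
    unfolding T_def using period(1) by (subst t_mod, intro Max_ge) auto
  have padic: "inverse (padic_abs p k) = real p ^ multiplicity p k" for k
    using p2 by (simp add: padic_abs_def powr_minus powr_realpow)
  have growth: "growth_rate s = real p ^ c"
    using p2 T by (rule growth_rate_eq) (use counts padic in simp)
  have s: "real (s k) = f (k mod \<omega>) (multiplicity p k) * real (p ^ c) ^ k" if "k \<ge> 1" for k
  proof -
    define v where "v = multiplicity p k"
    have "real (s k) = real p powr (real (c * k) + (- real (t k * p ^ v)))"
      using counts[OF that] by (simp add: padic v_def mult.commute)
    also have "\<dots> = real p powr real (c * k) * y ^ (t k * p ^ v)"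
      by (simp only: powr_add y_pow)
    also have "real p powr real (c * k) = (real p ^ c) ^ k"
      using p2 by (subst powr_realpow) (auto simp: power_mult)
    finally show ?thesis by (simp add: f_def v_def flip: t_mod)
  qed

  \<comment> \<open>Existence and value of the mean\<close>
  define B where "B = (real p - 1) / real \<omega> * (\<Sum>a<\<omega>. \<Sum>j. y ^ Suc j * f a j)"
  have f: "0 \<le> f a j" "f a j \<le> 1" "f a (Suc j) \<le> f a j" for a j
    using y p2 by (auto simp: f_def intro!: power_le_one power_decreasing)
  have "(\<Sum>k=1..n. real (s k) / growth_rate s ^ k) =
      (\<Sum>k=1..n. f (k mod \<omega>) (multiplicity p k))" for n
    using p2 by (intro sum.cong refl) (simp add: growth s)
  then have lim: "((\<lambda>x :: real. (1 / x) * (\<Sum>k = 1..nat \<lfloor>x\<rfloor>. real (s k) / growth_rate s ^ k))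
       \<longlongrightarrow> B) at_top"
    using sum_residue_valuation_approx[OF p2 period(1,2), of f, OF f]
    by (intro cesaro_mean_of_bounded_error[of _ B "2 * real \<omega>"]) (simp add: B_def y_def)
  have summand: "real p powr (- 1 - real j - real (t a) * real p ^ j) = y ^ Suc j * f a j" for a j
  proof -
    have "- 1 - real j - real (t a) * real p ^ j = - real (Suc j + t a * p ^ j)" by simp
    then show ?thesis by (simp only: y_pow power_add f_def)
  qed
  have B: "B = (real p - 1) / real \<omega> *
      (\<Sum>a = 0..\<omega> - 1. \<Sum>j. real p powr (- 1 - real j - real (t a) * real p ^ j))"
  proof -
    have "{0..\<omega> - 1} = {..<\<omega>}" using period(1) by auto
    then show ?thesis unfolding summand B_def by simp
  qed

  \<comment> \<open>Transcendence of the mean\<close>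
  define I where "I = {a. a < \<omega> \<and> t a \<noteq> 0}"
  define S where "S = (\<Sum>a\<in>I. \<Sum>j. y ^ (j + t a * p ^ j))"
  have fin: "finite I" and I: "I \<subseteq> {..<\<omega>}" by (auto simp: I_def)
  \<comment> \<open>Residues with \<open>t a = 0\<close> contribute a rational geometric sum, the
    others the lacunary series. Thus \<open>B\<close> is an affine function of \<open>S\<close> with
    rational coefficients and nonzero slope.\<close>
  have "(\<Sum>j. y ^ Suc j * f a j) = 1 / (real p - 1)" if "a \<in> {..<\<omega>} - I" for a
  proof -
    have "(\<lambda>j. y * y ^ j) sums (y * (1 / (1 - y)))"
      using y by (intro sums_mult geometric_sums) auto
    moreover have "y * (1 / (1 - y)) = 1 / (real p - 1)"
      using p2 by (simp add: y_def field_simps)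
    ultimately show ?thesis using that by (simp add: f_def I_def sums_iff)
  qed
  moreover have "(\<Sum>j. y ^ Suc j * f a j) = y * (\<Sum>j. y ^ (j + t a * p ^ j))" if "a \<in> I" for a
  proof -
    have "summable (\<lambda>j. y ^ (j + t a * p ^ j))"
      using that by (intro lacunary_series_tail(1)[OF p2 y_def]) (auto simp: I_def)
    then show ?thesis by (subst suminf_mult[symmetric]) (auto simp: f_def power_add mult.assoc)
  qed
  ultimately have "(\<Sum>a<\<omega>. \<Sum>j. y ^ Suc j * f a j) = real (card ({..<\<omega>} - I)) / (real p - 1) + y * S"
    by (subst sum.subset_diff[OF I]) (auto simp: S_def sum_distrib_left)
  then have BS: "B = (real p - 1) / real \<omega> * (real (card ({..<\<omega>} - I)) / (real p - 1) + y * S)"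
    by (simp add: B_def)
  have transcendental: "\<not> algebraic B" if "I \<noteq> {}"
  proof
    assume "algebraic B"
    then have "algebraic (real \<omega> * real p / (real p - 1) * B +
        (- (real p * real (card ({..<\<omega>} - I)) / (real p - 1))))"
      by (intro algebraic_affine) auto
    also have "real \<omega> * real p / (real p - 1) * B +
        (- (real p * real (card ({..<\<omega>} - I)) / (real p - 1))) = S"
    proof -
      have "w * q / \<alpha> * (\<alpha> / w * (k / \<alpha> + 1 / q * S)) + (- (q * k / \<alpha>)) = S"
        if "\<alpha> \<noteq> 0" "w \<noteq> 0" "q \<noteq> 0" for \<alpha> w q k :: real
      proof -
        have "w * q / \<alpha> * (\<alpha> / w * (k / \<alpha> + 1 / q * S)) = q * (k / \<alpha> + 1 / q * S)"
          using that by simp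
        also have "\<dots> = q * k / \<alpha> + S" using that by (simp add: distrib_left)
        finally show ?thesis by simp
      qed
      moreover have "real p - 1 \<noteq> 0" "real \<omega> \<noteq> 0" "real p \<noteq> 0" using p2 period(1) by auto
      ultimately show ?thesis unfolding BS y_def by blast
    qed
    finally have "algebraic S" .
    moreover have "\<not> algebraic S"
      unfolding S_def y_def
      using lacunary_sum_transcendental[OF p2 fin that, of t] by (auto simp: I_def)
    ultimately show False by blast
  qed
  have B1: "B = 1" if "I = {}"
    using p2 period(1) that by (simp add: BS S_def)
  have B1_iff: "B = 1 \<longleftrightarrow> I = {}"
    using B1 transcendental rat_imp_algebraic[of "1 :: real"] by auto
  have I_iff: "I = {} \<longleftrightarrow> (\<forall>a<\<omega>. t a = 0)" by (auto simp: I_def)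

  \<comment> \<open>Rationality of the zeta function\<close>
  have rat_iff: "fps_rational (dyn_zeta s) \<longleftrightarrow> (\<forall>a<\<omega>. t a = 0)"
  proof
    assume rat: "fps_rational (dyn_zeta s)"
    show "\<forall>a<\<omega>. t a = 0"
    proof (intro allI impI)
      fix a assume "a < \<omega>"
      then obtain J where "f a J = f a (Suc J)"
        using dyn_zeta_rational_imp_valuation_independent[OF rat p2 period(2), of "p ^ c" f a] s p2
        by auto
      \<comment> \<open>Powers of \<open>y\<close> with distinct exponents differ because
        \<open>0 < y < 1\<close>.\<close>
      then have "t a * p ^ J = t a * p ^ Suc J"
        using y by (simp only: f_def power_inject_exp')
      then show "t a = 0" using p2 by simp
    qed
  next
    assume "\<forall>a<\<omega>. t a = 0"
    then have t0: "t k = 0" for k using t_mod[of k] period(1) by simp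
    have "s k = (p ^ c) ^ k" if "k \<ge> 1" for k
    proof -
      have "real (s k) = real ((p ^ c) ^ k)" using s[OF that] by (simp add: f_def t0)
      then show ?thesis by (simp only: of_nat_eq_iff)
    qed
    then show "fps_rational (dyn_zeta s)" by (rule dyn_zeta_geometric_rational)
  qed
  show ?thesis
    using lim B B1_iff I_iff rat_iff transcendental by (intro exI[of _ B]) blast
qed

end
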